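(* Let $m\ge 3$ and let $\mu,\nu$ be characters such that $\mu$, $\nu$ and $\mu\nu$ are not $\equiv 1 \bmod q^{\mathbb Z}$. Then the operations $\mathfrak C_i^{\mu}$ on meromorphic functions satisfy the twisted braid relation $$\mathfrak C_1^{\nu}\,\mathfrak C_2^{\mu\nu}\,\mathfrak C_1^{\mu}=\mathfrak C_2^{\mu}\,\mathfrak C_1^{\mu\nu}\,\mathfrak C_2^{\nu}.$$ Moreover, for every $i\in\{1,\dots,m-1\}$, $$\mathfrak C_i^{\mu}\,\mathfrak C_i^{1/\mu}=\delta(h,\mu)\,\delta(h,1/\mu)\cdot\mathrm{id}.$$
   Context: For $\operatorname{Im}\tau>0$, $q=e^{2\pi i\tau}$, put $\theta_\tau(x)=2q^{1/8}\sin(\pi x)\prod_{n\ge1}(1-q^n)(1-q^ne^{2\pi i x})(1-q^ne^{-2\pi i x})$, $F_\tau(x,y)=\frac{\theta_\tau'(0)\theta_\tau(x+y)}{\theta_\tau(x)\theta_\tau(y)}$, and let $\delta=\delta_\tau$ be the meromorphic function on $\mathbb C^*\times\mathbb C^*$ with $\delta(e^{2\pi i x},e^{2\pi i y})=F_\tau(x,y)$. Consider meromorphic functions $f$ on $(\mathbb C^* )^{m+r+2}$ with coordinates $x_1,\dots,x_m,u,\mu_1,\dots,\mu_r,h$. For a character $\mu$, i.e. a Laurent monomial in the parameters $\mu_1,\dots,\mu_r$ (and $h$), with $\mu\not\equiv1\bmod q^{\mathbb Z}$, $$\mathfrak C_i^\mu(f)=\delta\big(\tfrac{x_{i+1}}{x_i},\mu\big)f+\delta\big(\tfrac{x_i}{x_{i+1}},h\big)\,s_if,\qquad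 i=1,\dots,m-1,$$ where $s_i$ exchanges $x_i$ and $x_{i+1}$ and fixes all other variables. Juxtaposition denotes composition of operators. *)

theory Defs
  imports "HOL-Complex_Analysis.Complex_Analysis"
begin

section \<open>The theta function and \<open>\<delta>\<close>\<close>

definition nome :: "complex \<Rightarrow> complex" where
  "nome \<tau> = exp (2 * of_real pi * \<i> * \<tau>)"

text \<open>The factor \<open>q\<close>\<open>\<^sup>1\<^sup>/\<^sup>8\<close> is the branch determined by \<open>\<tau>\<close>, that is \<open>exp (2 \<pi> \<i> \<tau> / 8)\<close>;
  the product over \<open>n \<ge> 1\<close> is indexed by \<open>n = Suc k\<close>.\<close>

definition theta :: "complex \<Rightarrow> complex \<Rightarrow> complex" where
  "theta \<tau> x = 2 * exp (2 * of_real pi * \<i> * \<tau> / 8) * sin (of_real pi * x) *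
     (\<Prod>k. (1 - nome \<tau> ^ Suc k) *
           (1 - nome \<tau> ^ Suc k * exp (2 * of_real pi * \<i> * x)) *
           (1 - nome \<tau> ^ Suc k * exp (- (2 * of_real pi * \<i> * x))))"

definition kronF :: "complex \<Rightarrow> complex \<Rightarrow> complex \<Rightarrow> complex" where
  "kronF \<tau> x y = deriv (theta \<tau>) 0 * theta \<tau> (x + y) / (theta \<tau> x * theta \<tau> y)"

text \<open>\<open>kronF \<tau>\<close> has period \<open>1\<close> in both arguments, so the choice of logarithms is immaterial;
  see \<open>delta_exp\<close> below. At its poles \<open>delta\<close> has the junk value \<open>0\<close>.\<close>

definition delta :: "complex \<Rightarrow> complex \<Rightarrow> complex \<Rightarrow> complex" where
  "delta \<tau> z w = kronF \<tau> (Ln z / (2 * of_real pi * \<i>)) (Ln w / (2 * of_real pi * \<i>))"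

lemma theta_plus_1: "theta \<tau> (x + 1) = - theta \<tau> x"
proof -
  have "exp (2 * of_real pi * \<i> * (x + 1)) = exp (2 * of_real pi * \<i> * x)"
    by (simp add: exp_add ring_distribs)
  moreover have "exp (- (2 * of_real pi * \<i> * (x + 1))) = exp (- (2 * of_real pi * \<i> * x))"
    using calculation by (simp add: exp_minus)
  moreover have "sin (of_real pi * (x + 1)) = - sin (of_real pi * x)"
    by (simp add: ring_distribs sin_add)
  ultimately show ?thesis
    unfolding theta_def by simp
qed

lemma kronF_plus_1: "kronF \<tau> (x + 1) y = kronF \<tau> x y" "kronF \<tau> x (y + 1) = kronF \<tau> x y"
proof -
  have "x + 1 + y = (x + y) + 1" "x + (y + 1) = (x + y) + 1" by simp_all
  then show "kronF \<tau> (x + 1) y = kronF \<tau> x y" "kronF \<tau> x (y + 1) = kronF \<tau> x y"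
    by (simp_all only: kronF_def theta_plus_1) simp_all
qed

lemma kronF_plus_int: "kronF \<tau> (x + of_int k) y = kronF \<tau> x y" "kronF \<tau> x (y + of_int k) = kronF \<tau> x y"
proof -
  have step: "g (z + of_int k) = g z" if "\<And>z. g (z + 1) = g z" for g :: "complex \<Rightarrow> complex" and z k
  proof (induction k rule: int_induct[where k = 0])
    case (step1 i)
    then show ?case using that[of "z + of_int i"] by (simp add: add.assoc)
  next
    case (step2 i)
    then show ?case using that[of "z + of_int (i - 1)"] by (simp add: add.assoc)
  qed simp
  show "kronF \<tau> (x + of_int k) y = kronF \<tau> x y"
    by (rule step[of "\<lambda>x. kronF \<tau> x y"]) (rule kronF_plus_1)
  show "kronF \<tau> x (y + of_int k) = kronF \<tau> x y"
    by (rule step[of "\<lambda>y. kronF \<tau> x y"]) (rule kronF_plus_1)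
qed

lemma delta_exp:
  "delta \<tau> (exp (2 * of_real pi * \<i> * x)) (exp (2 * of_real pi * \<i> * y)) = kronF \<tau> x y"
proof -
  have log: "\<exists>k. Ln (exp (2 * of_real pi * \<i> * x)) / (2 * of_real pi * \<i>) = x + of_int k" for x
  proof -
    have "exp (Ln (exp (2 * of_real pi * \<i> * x))) = exp (2 * of_real pi * \<i> * x)"
      by simp
    then obtain k where "Ln (exp (2 * of_real pi * \<i> * x)) =
        2 * of_real pi * \<i> * x + of_int (2 * k) * of_real pi * \<i>"
      unfolding exp_eq by auto
    then have "Ln (exp (2 * of_real pi * \<i> * x)) / (2 * of_real pi * \<i>) = x + of_int k"
      by (simp add: field_simps)
    then show ?thesis ..
  qed
  from log[of x] log[of y] show ?thesis
    unfolding delta_def by (auto simp: kronF_plus_int)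
qed


section \<open>Meromorphic functions on the torus\<close>

text \<open>The coordinates \<open>x\<^sub>1, \<dots>, x\<^sub>m, u, \<mu>\<^sub>1, \<dots>, \<mu>\<^sub>r, h\<close>.\<close>

datatype coord = cX nat | cU | cMu nat | cH

type_synonym point = "coord \<Rightarrow> complex"

definition coords :: "nat \<Rightarrow> nat \<Rightarrow> coord set" where
  "coords m r = cX ` {1..m} \<union> {cU} \<union> cMu ` {1..r} \<union> {cH}"

text \<open>The space \<open>(\<complex>\<^sup>*)\<^sup>m\<^sup>+\<^sup>r\<^sup>+\<^sup>2\<close>; its points take the value \<open>undefined\<close> outside \<open>coords m r\<close>.\<close>

definition torus :: "nat \<Rightarrow> nat \<Rightarrow> point topology" where
  "torus m r = product_topology (\<lambda>_. top_of_set (- {0})) (coords m r)"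

text \<open>Holomorphy in several variables: continuous, and holomorphic in each variable separately.\<close>

definition holo_on :: "nat \<Rightarrow> nat \<Rightarrow> point set \<Rightarrow> (point \<Rightarrow> complex) \<Rightarrow> bool" where
  "holo_on m r V g \<longleftrightarrow>
     continuous_map (subtopology (torus m r) V) euclidean g \<and>
     (\<forall>z\<in>V. \<forall>c\<in>coords m r. (\<lambda>t. g (z(c := t))) field_differentiable at (z c))"

text \<open>A meromorphic function is locally a quotient \<open>g / d\<close> of holomorphic functions, where \<open>d\<close>
  vanishes identically on no nonempty open set. Functions are total here, so a meromorphic
  function is given by a representative with arbitrary values on the zero sets of such \<open>d\<close>.\<close>

definition mero :: "nat \<Rightarrow> nat \<Rightarrow> (point \<Rightarrow> complex) \<Rightarrow> bool" where
  "mero m r f \<longleftrightarrow>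
     (\<forall>p\<in>topspace (torus m r). \<exists>V g d. openin (torus m r) V \<and> p \<in> V \<and>
        holo_on m r V g \<and> holo_on m r V d \<and>
        (\<forall>W. openin (torus m r) W \<and> W \<subseteq> V \<and> W \<noteq> {} \<longrightarrow> (\<exists>z\<in>W. d z \<noteq> 0)) \<and>
        (\<forall>z\<in>V. d z \<noteq> 0 \<longrightarrow> f z = g z / d z))"

text \<open>Two representatives define the same meromorphic function iff they agree on a dense open
  subset of the torus.\<close>

definition mero_eq :: "nat \<Rightarrow> nat \<Rightarrow> (point \<Rightarrow> complex) \<Rightarrow> (point \<Rightarrow> complex) \<Rightarrow> bool" where
  "mero_eq m r f g \<longleftrightarrow>
     (\<exists>W. openin (torus m r) W \<and> torus m r closure_of W = topspace (torus m r) \<and>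
          (\<forall>z\<in>W. f z = g z))"


section \<open>Characters and the operators\<close>

definition character :: "nat \<Rightarrow> (point \<Rightarrow> complex) \<Rightarrow> bool" where
  "character r \<kappa> \<longleftrightarrow>
     (\<exists>(a :: nat \<Rightarrow> int) b. \<kappa> = (\<lambda>z. (\<Prod>j = 1..r. z (cMu j) powi a j) * z cH powi b))"

definition trivial_mod_q :: "complex \<Rightarrow> nat \<Rightarrow> nat \<Rightarrow> (point \<Rightarrow> complex) \<Rightarrow> bool" where
  "trivial_mod_q \<tau> m r \<kappa> \<longleftrightarrow>
     (\<exists>k :: int. \<forall>z\<in>topspace (torus m r). \<kappa> z = nome \<tau> powi k)"

definition swap :: "nat \<Rightarrow> (point \<Rightarrow> complex) \<Rightarrow> (point \<Rightarrow> complex)" where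
  "swap i f = (\<lambda>z. f (z(cX i := z (cX (i + 1)), cX (i + 1) := z (cX i))))"

definition frakC :: "complex \<Rightarrow> nat \<Rightarrow> (point \<Rightarrow> complex) \<Rightarrow> (point \<Rightarrow> complex) \<Rightarrow> (point \<Rightarrow> complex)"
  where
  "frakC \<tau> i \<kappa> f = (\<lambda>z. delta \<tau> (z (cX (i + 1)) / z (cX i)) (\<kappa> z) * f z +
                         delta \<tau> (z (cX i) / z (cX (i + 1))) (z cH) * swap i f z)"


section \<open>The operators act on meromorphic functions\<close>

text \<open>\<open>mero_eq_frakC\<close>: the operators respect equality of meromorphic functions;
  \<open>mero_frakC\<close>: they preserve meromorphy.\<close>


lemma topspace_torus: "topspace (torus m r) = (\<Pi>\<^sub>E c\<in>coords m r. - {0})"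
  by (simp add: torus_def)

lemma coord_continuous: "c \<in> coords m r \<Longrightarrow> continuous_map (torus m r) euclidean (\<lambda>z. z c)"
  unfolding torus_def
  using continuous_map_product_projection[of c "coords m r" "\<lambda>_. top_of_set (- {0::complex})"]
  by (simp add: continuous_map_in_subtopology)

lemma slice_continuous:
  assumes "z \<in> topspace (torus m r)" "c \<in> coords m r"
  shows "continuous_map (top_of_set (- {0})) (torus m r) (\<lambda>t. z(c := t))"
  unfolding torus_def continuous_map_componentwise
proof (intro conjI ballI)
  show "(\<lambda>t. z(c := t)) ` topspace (top_of_set (- {0})) \<subseteq> extensional (coords m r)"
    using assms by (auto simp: topspace_torus PiE_def extensional_def)
  fix k assume "k \<in> coords m r"
  then show "continuous_map (top_of_set (- {0})) (top_of_set (- {0})) (\<lambda>t. (z(c := t)) k)"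
    using assms by (cases "k = c") (auto simp: topspace_torus PiE_def Pi_def)
qed

lemma slice_open:
  assumes "openin (torus m r) W" "z \<in> W" "c \<in> coords m r"
  obtains S where "open S" "z c \<in> S" "0 \<notin> S" "\<And>t. t \<in> S \<Longrightarrow> z(c := t) \<in> W"
proof -
  have z: "z \<in> topspace (torus m r)" using assms openin_subset by blast
  have "openin (top_of_set (- {0})) {t \<in> topspace (top_of_set (- {0})). z(c := t) \<in> W}"
    using slice_continuous[OF z assms(3)] assms(1) by (rule openin_continuous_map_preimage)
  moreover have "{t \<in> topspace (top_of_set (- {0})). z(c := t) \<in> W} = {t. t \<noteq> 0 \<and> z(c := t) \<in> W}"
    by auto
  ultimately have "open {t. t \<noteq> 0 \<and> z(c := t) \<in> W}"
    using openin_open_eq[of "- {0::complex}"] by (simp add: open_Compl)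
  moreover have "z c \<noteq> 0" using z assms(3) by (auto simp: topspace_torus PiE_def Pi_def)
  ultimately show ?thesis
    by (intro that[of "{t. t \<noteq> 0 \<and> z(c := t) \<in> W}"]) (use assms(2) in simp_all)
qed

definition swp :: "nat \<Rightarrow> point \<Rightarrow> point" where
  "swp i z = z(cX i := z (cX (i + 1)), cX (i + 1) := z (cX i))"

lemma swap_swp: "swap i f z = f (swp i z)" by (simp add: swap_def swp_def)
lemma swp_swp [simp]: "swp i (swp i z) = z" by (auto simp: swp_def)

context fixes m i :: nat assumes i: "1 \<le> i" "i < m"
begin

lemma cX_coords: "cX i \<in> coords m r" "cX (Suc i) \<in> coords m r"
  using i by (auto simp: coords_def)

lemma swp_continuous: "continuous_map (torus m r) (torus m r) (swp i)"
  unfolding torus_def continuous_map_componentwise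
proof (intro conjI ballI)
  show "swp i ` topspace (product_topology (\<lambda>_. top_of_set (- {0})) (coords m r)) \<subseteq> extensional (coords m r)"
    using cX_coords by (auto simp: PiE_def extensional_def swp_def)
  fix k assume k: "k \<in> coords m r"
  define k' where "k' = (if k = cX i then cX (i+1) else if k = cX (i+1) then cX i else k)"
  have "k' \<in> coords m r" using k cX_coords by (auto simp: k'_def)
  moreover have "(\<lambda>z. swp i z k) = (\<lambda>z. z k')" by (auto simp: swp_def k'_def)
  ultimately show "continuous_map (product_topology (\<lambda>_. top_of_set (- {0})) (coords m r)) (top_of_set (- {0})) (\<lambda>z. swp i z k)"
    using continuous_map_product_projection[of k' "coords m r" "\<lambda>_. top_of_set (- {0::complex})"] by simp
qed

lemma swp_homeo: "homeomorphic_maps (torus m r) (torus m r) (swp i) (swp i)"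
  by (simp add: homeomorphic_maps_def swp_continuous)

lemma swp_homeo': "homeomorphic_map (torus m r) (torus m r) (swp i)"
  using swp_homeo homeomorphic_map_maps by blast

lemma swp_image: "swp i ` A = {z. swp i z \<in> A}"
  by (auto simp: image_iff) (metis swp_swp)

lemma swp_open: "openin (torus m r) W \<Longrightarrow> openin (torus m r) (swp i ` W)"
  using homeomorphic_map_openness_eq[OF swp_homeo'] by blast

lemma mero_eq_frakC:
  assumes "mero_eq m r f g"
  shows "mero_eq m r (frakC \<tau> i \<kappa> f) (frakC \<tau> i \<kappa> g)"
proof -
  obtain W where W: "openin (torus m r) W" "torus m r closure_of W = topspace (torus m r)"
    "\<forall>z\<in>W. f z = g z" using assms by (auto simp: mero_eq_def)
  have W': "openin (torus m r) (swp i ` W)" using W(1) by (rule swp_open)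
  have "torus m r closure_of (swp i ` W) = topspace (torus m r)"
    using homeomorphic_map_closure_of[OF swp_homeo' openin_subset[OF W(1)]] W(2)
      homeomorphic_imp_surjective_map[OF swp_homeo'] by metis
  then have "torus m r closure_of (W \<inter> swp i ` W) = topspace (torus m r)"
    using W(2) unfolding dense_intersects_open Int_assoc
    using W' openin_Int by blast
  moreover have "frakC \<tau> i \<kappa> f z = frakC \<tau> i \<kappa> g z" if "z \<in> W \<inter> swp i ` W" for z
    using that W(3) by (auto simp: frakC_def swap_swp)
  ultimately show ?thesis
    unfolding mero_eq_def using W W' by (intro exI[of _ "W \<inter> swp i ` W"]) auto
qed
end

text \<open>In the multiplicative coordinate \<open>z = exp (2 \<pi> \<i> x)\<close> the theta function is, up to a
  unit, a single-valued holomorphic function \<open>theta_mult\<close> on \<open>\<complex>\<^sup>*\<close> with zeros only in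
  \<open>q\<close>-powers.\<close>

definition euler_fn :: "complex \<Rightarrow> complex \<Rightarrow> complex" where
  "euler_fn q w = (\<Prod>k. 1 - q ^ Suc k * w)"

lemma euler_fn_convergent: "norm (q::complex) < 1 \<Longrightarrow> convergent_prod (\<lambda>k. 1 - q ^ Suc k * w)"
proof -
  assume "norm q < 1"
  then have "summable (\<lambda>k. norm q ^ k)" by (simp add: summable_geometric)
  then have "summable (\<lambda>k. norm q * norm w * norm q ^ k)" by (rule summable_mult)
  moreover have "norm (1 - q ^ Suc k * w - 1) = norm q * norm w * norm q ^ k" for k
    by (simp add: norm_mult norm_power)
  ultimately have "summable (\<lambda>k. norm (1 - q ^ Suc k * w - 1))"
    by presburger
  then show ?thesis
    by (intro abs_convergent_prod_imp_convergent_prod summable_imp_abs_convergent_prod)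
qed

lemma euler_fn_zero: "norm q < 1 \<Longrightarrow> euler_fn q w = 0 \<Longrightarrow> \<exists>k. q ^ Suc k * w = 1"
  unfolding euler_fn_def using prodinf_nonzero[OF euler_fn_convergent] by (metis right_minus_eq)

lemma euler_fn_holomorphic: "norm q < 1 \<Longrightarrow> euler_fn q holomorphic_on UNIV"
proof (rule holomorphic_uniform_sequence[where f = "\<lambda>n w. \<Prod>k<n. 1 - q ^ Suc k * w"])
  assume q: "norm q < 1"
  fix x :: complex
  define B where "B = norm x + 1"
  have B: "norm w \<le> B" if "w \<in> cball x 1" for w
    using that norm_triangle_ineq2[of w x] by (simp add: B_def dist_norm norm_minus_commute)
  have "uniformly_convergent_on (cball x 1) (\<lambda>N w. \<Sum>n<N. norm (- (q ^ Suc n * w)))"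
  proof (rule Weierstrass_m_test'[where M = "\<lambda>n. norm q * B * norm q ^ n"])
    show "summable (\<lambda>n. norm q * B * norm q ^ n)"
      using q by (intro summable_mult summable_geometric) simp
    fix n w assume "w \<in> cball x 1"
    then show "norm (norm (- (q ^ Suc n * w))) \<le> norm q * B * norm q ^ n"
      using mult_left_mono[OF B, of w "norm q * norm q ^ n"]
      by (simp add: norm_mult norm_power mult_ac)
  qed
  then have "uniformly_convergent_on (cball x 1) (\<lambda>N w. \<Prod>n<N. 1 + - (q ^ Suc n * w))"
    by (intro uniformly_convergent_on_prod) (auto intro!: continuous_intros)
  then obtain l where l: "uniform_limit (cball x 1) (\<lambda>N w. \<Prod>n<N. 1 - q ^ Suc n * w) l sequentially"
    by (auto simp: uniformly_convergent_on_def)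
  have "l w = euler_fn q w" if "w \<in> cball x 1" for w
  proof -
    have "(\<lambda>N. \<Prod>n<N. 1 - q ^ Suc n * w) \<longlonglongrightarrow> l w"
      using tendsto_uniform_limitI[OF l that] .
    moreover have "(\<lambda>N. \<Prod>n<N. 1 - q ^ Suc n * w) \<longlonglongrightarrow> euler_fn q w"
      unfolding euler_fn_def using convergent_prod_LIMSEQ[OF euler_fn_convergent[OF q]]
      using LIMSEQ_lessThan_iff_atMost by blast
    ultimately show ?thesis by (rule LIMSEQ_unique)
  qed
  then have "uniform_limit (cball x 1) (\<lambda>N w. \<Prod>n<N. 1 - q ^ Suc n * w) (euler_fn q) sequentially"
    using l by (metis (no_types, lifting) uniform_limit_cong')
  then show "\<exists>d>0. cball x d \<subseteq> UNIV \<and> uniform_limit (cball x d) (\<lambda>n w. \<Prod>k<n. 1 - q ^ Suc k * w) (euler_fn q) sequentially"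
    by (intro exI[of _ 1]) auto
qed (auto intro!: holomorphic_intros)

lemma nome_less_1: "Im \<tau> > 0 \<Longrightarrow> norm (nome \<tau>) < 1"
  by (simp add: nome_def norm_exp_eq_Re)

definition theta_mult :: "complex \<Rightarrow> complex \<Rightarrow> complex" where
  "theta_mult \<tau> z = (z - 1) * (euler_fn (nome \<tau>) 1 * euler_fn (nome \<tau>) z * euler_fn (nome \<tau>) (1 / z))"

lemma theta_mult_holomorphic: "Im \<tau> > 0 \<Longrightarrow> theta_mult \<tau> holomorphic_on - {0}"
  unfolding theta_mult_def
  by (intro holomorphic_intros holomorphic_on_compose_gen[OF _ euler_fn_holomorphic, unfolded o_def]
      holomorphic_on_subset[OF euler_fn_holomorphic] nome_less_1) auto

lemma theta_mult_zero: 
  assumes "Im \<tau> > 0" "theta_mult \<tau> z = 0" "z \<noteq> 0"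
  shows "z \<in> range (\<lambda>k::int. nome \<tau> powi k)"
proof -
  note q = nome_less_1[OF assms(1)]
  have pw: "nome \<tau> ^ Suc k \<noteq> 1" for k
  proof
    assume "nome \<tau> ^ Suc k = 1"
    then have "norm (nome \<tau>) ^ Suc k = 1" by (metis norm_one norm_power)
    then show False using q power_Suc_less_one[of "norm (nome \<tau>)" k] by (simp add: nome_def)
  qed
  consider "z = 1" | "euler_fn (nome \<tau>) 1 = 0" | "euler_fn (nome \<tau>) z = 0" | "euler_fn (nome \<tau>) (1 / z) = 0"
    using assms(2) by (auto simp: theta_mult_def)
  then show ?thesis
  proof cases
    case 1 then show ?thesis by (intro image_eqI[of _ _ 0]) auto
  next
    case 2 then show ?thesis using euler_fn_zero[OF q 2] pw by auto
  next
    case 3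
    obtain k where "nome \<tau> ^ Suc k * z = 1" using euler_fn_zero[OF q 3] by auto
    then have "z = nome \<tau> powi (- int (Suc k))"
      unfolding power_int_minus power_int_of_nat by (metis inverse_unique)
    then show ?thesis by blast
  next
    case 4
    obtain k where "nome \<tau> ^ Suc k * (1 / z) = 1" using euler_fn_zero[OF q 4] by auto
    then have "z = nome \<tau> powi (int (Suc k))"
      using assms(3) unfolding power_int_of_nat by (simp add: field_simps del: power_Suc)
    then show ?thesis by blast
  qed
qed

lemma theta_theta_mult:
  assumes "Im \<tau> > 0"
  shows "theta \<tau> x = exp (2 * of_real pi * \<i> * \<tau> / 8) / \<i> * exp (- (of_real pi * \<i> * x)) * theta_mult \<tau> (exp (2 * of_real pi * \<i> * x))"
proof -
  note q = nome_less_1[OF assms]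
  let ?e = "exp (2 * of_real pi * \<i> * x)"
  have "(\<Prod>k. (1 - nome \<tau> ^ Suc k) * (1 - nome \<tau> ^ Suc k * ?e) * (1 - nome \<tau> ^ Suc k * exp (- (2 * of_real pi * \<i> * x))))
     = euler_fn (nome \<tau>) 1 * euler_fn (nome \<tau>) ?e * euler_fn (nome \<tau>) (1 / ?e)"
    unfolding euler_fn_def using euler_fn_convergent[OF q]
    using euler_fn_convergent[OF q, of 1] euler_fn_convergent[OF q, of ?e] euler_fn_convergent[OF q, of "1 / ?e"]
    by (simp add: prodinf_mult convergent_prod_mult exp_minus inverse_eq_divide del: power_Suc)
  moreover have "sin (of_real pi * x) = exp (- (of_real pi * \<i> * x)) * (?e - 1) / (2 * \<i>)"
  proof -
    have "?e = exp (of_real pi * \<i> * x) * exp (of_real pi * \<i> * x)"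
      by (simp add: algebra_simps flip: exp_add)
    then show ?thesis
      unfolding sin_exp_eq by (simp add: field_simps exp_minus)
  qed
  ultimately show ?thesis
    unfolding theta_def theta_mult_def by simp
qed

lemma delta_theta_mult:
  assumes "Im \<tau> > 0" "z \<noteq> 0" "w \<noteq> 0"
  shows "delta \<tau> z w = (deriv (theta \<tau>) 0 * \<i> / exp (2 * of_real pi * \<i> * \<tau> / 8)) * theta_mult \<tau> (z * w) / (theta_mult \<tau> z * theta_mult \<tau> w)"
proof -
  define x y where "x = Ln z / (2 * of_real pi * \<i>)" and "y = Ln w / (2 * of_real pi * \<i>)"
  have z: "exp (2 * of_real pi * \<i> * x) = z" and w: "exp (2 * of_real pi * \<i> * y) = w"
    using assms by (simp_all add: x_def y_def)
  have zw: "exp (2 * of_real pi * \<i> * (x + y)) = z * w"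
    using z w by (simp add: ring_distribs exp_add)
  have "exp (- (of_real pi * \<i> * (x + y))) = exp (- (of_real pi * \<i> * x)) * exp (- (of_real pi * \<i> * y))"
    by (simp add: ring_distribs flip: exp_add)
  then show ?thesis
    unfolding delta_def kronF_def x_def[symmetric] y_def[symmetric] theta_theta_mult[OF assms(1)] z w zw
    by (simp add: field_simps)
qed


lemma continuous_map_cmult:
  fixes f g :: "'a \<Rightarrow> complex"
  assumes "continuous_map X euclidean f" "continuous_map X euclidean g"
  shows "continuous_map X euclidean (\<lambda>x. f x * g x)" "continuous_map X euclidean (\<lambda>x. f x + g x)"
proof -
  have p: "continuous_map X euclidean (\<lambda>x. (f x, g x))"
    using continuous_map_pairedI[OF assms] by simp
  have "continuous_map euclidean euclidean (\<lambda>p::complex\<times>complex. fst p * snd p)"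
    "continuous_map euclidean euclidean (\<lambda>p::complex\<times>complex. fst p + snd p)"
    by (auto intro!: continuous_intros)
  then show "continuous_map X euclidean (\<lambda>x. f x * g x)" "continuous_map X euclidean (\<lambda>x. f x + g x)"
    using continuous_map_compose[OF p, of euclidean "\<lambda>p. fst p * snd p"]
      continuous_map_compose[OF p, of euclidean "\<lambda>p. fst p + snd p"] by (simp_all add: o_def)
qed

lemma holo_mult: "holo_on m r V f \<Longrightarrow> holo_on m r V g \<Longrightarrow> holo_on m r V (\<lambda>z. f z * g z)"
  unfolding holo_on_def by (auto intro!: continuous_map_cmult field_differentiable_mult)
lemma holo_add: "holo_on m r V f \<Longrightarrow> holo_on m r V g \<Longrightarrow> holo_on m r V (\<lambda>z. f z + g z)"
  unfolding holo_on_def by (auto intro!: continuous_map_cmult field_differentiable_add)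
lemma holo_const: "holo_on m r V (\<lambda>z. k)"
  unfolding holo_on_def by auto
lemma holo_prod: "(\<And>j. j \<in> J \<Longrightarrow> holo_on m r V (f j)) \<Longrightarrow> holo_on m r V (\<lambda>z. \<Prod>j\<in>J. f j z)"
  by (induction J rule: infinite_finite_induct) (auto intro: holo_const holo_mult)
lemma holo_coord: "c \<in> coords m r \<Longrightarrow> holo_on m r V (\<lambda>z. z c)"
  unfolding holo_on_def
proof (intro conjI ballI)
  fix z c' 
  show "(\<lambda>t. (z(c' := t)) c) field_differentiable at (z c')"
    by (cases "c = c'") (auto intro: field_differentiable_ident)
qed (auto intro: continuous_map_from_subtopology coord_continuous)
lemma holo_comp:
  assumes "holo_on m r V f" "V \<subseteq> topspace (torus m r)" "p holomorphic_on S" "open S" "\<And>z. z \<in> V \<Longrightarrow> f z \<in> S"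
  shows "holo_on m r V (\<lambda>z. p (f z))"
  unfolding holo_on_def
proof (intro conjI ballI)
  have "continuous_map (subtopology (torus m r) V) (top_of_set S) f"
    using assms by (auto simp: holo_on_def continuous_map_in_subtopology)
  moreover have "continuous_map (top_of_set S) euclidean p"
    using holomorphic_on_imp_continuous_on[OF assms(3)] by simp
  ultimately show "continuous_map (subtopology (torus m r) V) euclidean (\<lambda>z. p (f z))"
    using continuous_map_compose unfolding o_def by blast
  fix z c assume zc: "z \<in> V" "c \<in> coords m r"
  have "p field_differentiable at (f (z(c := z c)))"
    using assms zc by (simp add: holomorphic_on_imp_differentiable_at)
  then show "(\<lambda>t. p (f (z(c := t)))) field_differentiable at (z c)"
    using field_differentiable_compose[of "\<lambda>t. f (z(c := t))" "z c" p] assms(1) zc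
    by (auto simp: holo_on_def o_def)
qed
lemma holo_subset: "holo_on m r V f \<Longrightarrow> V' \<subseteq> V \<Longrightarrow> holo_on m r V' f"
  unfolding holo_on_def using continuous_map_from_subtopology_mono by blast

definition nonvanishing :: "nat \<Rightarrow> nat \<Rightarrow> point set \<Rightarrow> (point \<Rightarrow> complex) \<Rightarrow> bool" where
  "nonvanishing m r V d \<longleftrightarrow> (\<forall>W. openin (torus m r) W \<and> W \<subseteq> V \<and> W \<noteq> {} \<longrightarrow> (\<exists>z\<in>W. d z \<noteq> 0))"

lemma nonvanishing_mult:
  assumes "openin (torus m r) V" "holo_on m r V d" "nonvanishing m r V d" "nonvanishing m r V e"
  shows "nonvanishing m r V (\<lambda>z. d z * e z)"
  unfolding nonvanishing_def
proof (intro allI impI, elim conjE)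
  fix W assume W: "openin (torus m r) W" "W \<subseteq> V" "W \<noteq> {}"
  define W' where "W' = {z \<in> W. d z \<noteq> 0}"
  have "continuous_map (subtopology (torus m r) W) euclidean d"
    using holo_subset[OF assms(2) W(2)] by (simp add: holo_on_def)
  then have "openin (subtopology (torus m r) W) {z \<in> topspace (subtopology (torus m r) W). d z \<in> - {0}}"
    by (rule openin_continuous_map_preimage) auto
  moreover have "{z \<in> topspace (subtopology (torus m r) W). d z \<in> - {0}} = W'"
    using openin_subset[OF W(1)] by (auto simp: W'_def)
  ultimately have "openin (torus m r) W'" using W(1) openin_trans_full by blast
  moreover have "W' \<noteq> {}" using assms(3) W unfolding nonvanishing_def W'_def by blast
  moreover have "W' \<subseteq> V" using W(2) by (auto simp: W'_def)
  ultimately obtain z where "z \<in> W'" "e z \<noteq> 0" using assms(4) unfolding nonvanishing_def by blast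
  then show "\<exists>z\<in>W. d z * e z \<noteq> 0" by (auto simp: W'_def)
qed

lemma nonvanishing_subset: "nonvanishing m r V d \<Longrightarrow> V' \<subseteq> V \<Longrightarrow> nonvanishing m r V' d"
  unfolding nonvanishing_def by blast

lemma mero_nonvanishing: "mero m r f \<longleftrightarrow>
     (\<forall>p\<in>topspace (torus m r). \<exists>V g d. openin (torus m r) V \<and> p \<in> V \<and>
        holo_on m r V g \<and> holo_on m r V d \<and> nonvanishing m r V d \<and> (\<forall>z\<in>V. d z \<noteq> 0 \<longrightarrow> f z = g z / d z))"
  unfolding mero_def nonvanishing_def ..

lemma mero_op:
  assumes "mero m r f" "mero m r g"
  shows "mero m r (\<lambda>z. f z * g z)" "mero m r (\<lambda>z. f z + g z)"
proof -
  have *: "(\<exists>V a d. openin (torus m r) V \<and> p \<in> V \<and>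
        holo_on m r V a \<and> holo_on m r V d \<and> nonvanishing m r V d \<and> (\<forall>z\<in>V. d z \<noteq> 0 \<longrightarrow> f z * g z = a z / d z)) \<and>
     (\<exists>V a d. openin (torus m r) V \<and> p \<in> V \<and>
        holo_on m r V a \<and> holo_on m r V d \<and> nonvanishing m r V d \<and> (\<forall>z\<in>V. d z \<noteq> 0 \<longrightarrow> f z + g z = a z / d z))"
    if p: "p \<in> topspace (torus m r)" for p
  proof -
    obtain V a d where 1: "openin (torus m r) V" "p \<in> V"
        "holo_on m r V a" "holo_on m r V d" "nonvanishing m r V d" "\<forall>z\<in>V. d z \<noteq> 0 \<longrightarrow> f z = a z / d z"
      using assms(1) p unfolding mero_nonvanishing by meson
    obtain V' a' d' where 2: "openin (torus m r) V'" "p \<in> V'"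
        "holo_on m r V' a'" "holo_on m r V' d'" "nonvanishing m r V' d'" "\<forall>z\<in>V'. d' z \<noteq> 0 \<longrightarrow> g z = a' z / d' z"
      using assms(2) p unfolding mero_nonvanishing by meson
    let ?V = "V \<inter> V'"
    have o: "openin (torus m r) ?V" "p \<in> ?V" using 1 2 by auto
    have h: "holo_on m r ?V a" "holo_on m r ?V d" "holo_on m r ?V a'" "holo_on m r ?V d'"
      using 1 2 holo_subset by (metis Int_lower1 Int_lower2)+
    have n: "nonvanishing m r ?V (\<lambda>z. d z * d' z)"
      using 1 2 h o by (intro nonvanishing_mult) (auto intro: nonvanishing_subset)
    show ?thesis
    proof (intro conjI)
      show "\<exists>V a d. openin (torus m r) V \<and> p \<in> V \<and>
        holo_on m r V a \<and> holo_on m r V d \<and> nonvanishing m r V d \<and> (\<forall>z\<in>V. d z \<noteq> 0 \<longrightarrow> f z * g z = a z / d z)"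
        by (rule exI[of _ ?V], rule exI[of _ "\<lambda>z. a z * a' z"], rule exI[of _ "\<lambda>z. d z * d' z"])
           (use o h n 1 2 in \<open>auto intro!: holo_mult\<close>)
      show "\<exists>V a d. openin (torus m r) V \<and> p \<in> V \<and>
        holo_on m r V a \<and> holo_on m r V d \<and> nonvanishing m r V d \<and> (\<forall>z\<in>V. d z \<noteq> 0 \<longrightarrow> f z + g z = a z / d z)"
        by (rule exI[of _ ?V], rule exI[of _ "\<lambda>z. a z * d' z + a' z * d z"], rule exI[of _ "\<lambda>z. d z * d' z"])
           (use o h n 1 2 in \<open>auto intro!: holo_mult holo_add simp: add_frac_eq\<close>)
    qed
  qed
  then show "mero m r (\<lambda>z. f z * g z)" "mero m r (\<lambda>z. f z + g z)"
    unfolding mero_nonvanishing by blast+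
qed

lemma mero_swap:
  assumes "1 \<le> i" "i < m" "mero m r f"
  shows "mero m r (swap i f)"
  unfolding mero_nonvanishing
proof
  fix p assume p: "p \<in> topspace (torus m r)"
  note c = swp_continuous[OF assms(1,2), of r]
  have sp: "swp i p \<in> topspace (torus m r)"
    using continuous_map_image_subset_topspace[OF c] p by auto
  obtain V g d where 1: "openin (torus m r) V" "swp i p \<in> V"
        "holo_on m r V g" "holo_on m r V d" "nonvanishing m r V d" "\<forall>z\<in>V. d z \<noteq> 0 \<longrightarrow> f z = g z / d z"
      using assms(3) sp unfolding mero_nonvanishing by meson
  let ?V = "swp i ` V"
  note im = swp_image[OF assms(1,2)]
  have h: "holo_on m r ?V (\<lambda>z. g (swp i z))" if "holo_on m r V g" for g
    unfolding holo_on_def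
  proof (intro conjI ballI)
    have "continuous_map (subtopology (torus m r) ?V) (subtopology (torus m r) V) (swp i)"
      using c by (auto simp: continuous_map_in_subtopology continuous_map_from_subtopology im)
    then show "continuous_map (subtopology (torus m r) ?V) euclidean (\<lambda>z. g (swp i z))"
      using continuous_map_compose that unfolding o_def holo_on_def by blast
    fix z k assume z: "z \<in> ?V" and k: "k \<in> coords m r"
    define k' where "k' = (if k = cX i then cX (i+1) else if k = cX (i+1) then cX i else k)"
    have "k' \<in> coords m r" using k cX_coords[OF assms(1,2)] by (auto simp: k'_def)
    moreover have "swp i z k' = z k" by (auto simp: swp_def k'_def)
    moreover have "swp i (z(k := t)) = (swp i z)(k' := t)" for t by (auto simp: swp_def k'_def)
    moreover have "swp i z \<in> V" using z by (simp add: im)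
    ultimately have "(\<lambda>t. g ((swp i z)(k' := t))) field_differentiable at (swp i z k')"
      using that unfolding holo_on_def by blast
    then show "(\<lambda>t. g (swp i (z(k := t)))) field_differentiable at (z k)"
      using \<open>\<And>t. swp i (z(k := t)) = (swp i z)(k' := t)\<close> \<open>swp i z k' = z k\<close> by simp
  qed
  have n: "nonvanishing m r ?V (\<lambda>z. d (swp i z))"
    unfolding nonvanishing_def
  proof (intro allI impI, elim conjE)
    fix W assume W: "openin (torus m r) W" "W \<subseteq> ?V" "W \<noteq> {}"
    have "swp i ` W \<subseteq> V" using W(2) by (auto simp: im)
    then obtain z where "z \<in> swp i ` W" "d z \<noteq> 0"
      using 1(5) W swp_open[OF assms(1,2) W(1)] unfolding nonvanishing_def by blast
    then show "\<exists>z\<in>W. d (swp i z) \<noteq> 0" by auto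
  qed
  show "\<exists>V g d. openin (torus m r) V \<and> p \<in> V \<and>
        holo_on m r V g \<and> holo_on m r V d \<and> nonvanishing m r V d \<and> (\<forall>z\<in>V. d z \<noteq> 0 \<longrightarrow> swap i f z = g z / d z)"
    by (rule exI[of _ ?V], rule exI[of _ "\<lambda>z. g (swp i z)"], rule exI[of _ "\<lambda>z. d (swp i z)"])
       (use 1 h n swp_open[OF assms(1,2)] in \<open>auto simp: im swap_swp\<close>)
qed

text \<open>The arguments at which \<open>delta\<close> is evaluated: invertible holomorphic functions that are a
  nontrivial monomial in at least one of the coordinates.\<close>

definition admissible :: "nat \<Rightarrow> nat \<Rightarrow> (point \<Rightarrow> complex) \<Rightarrow> bool" where
  "admissible m r \<phi> \<longleftrightarrow> holo_on m r (topspace (torus m r)) \<phi> \<and> (\<forall>z\<in>topspace (torus m r). \<phi> z \<noteq> 0) \<and>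
    (\<exists>c\<in>coords m r. \<exists>e::int. e \<noteq> 0 \<and> (\<forall>z\<in>topspace (torus m r). \<forall>t. t \<noteq> 0 \<longrightarrow> \<phi> (z(c := t)) = \<phi> z * (t / z c) powi e))"

lemma countable_root:
  assumes "e \<noteq> (0::int)" shows "finite {t::complex. t powi e = a}"
proof -
  have f: "finite {t::complex. t ^ n = b}" if "n > 0" for n b
    using that by (metis finite_nth_roots)
  show ?thesis
  proof (cases "e > 0")
    case True
    then show ?thesis using f[of "nat e" a] by (simp add: power_int_def)
  next
    case False
    then have "{t::complex. t powi e = a} \<subseteq> {t. t ^ nat (- e) = inverse a}"
      using assms by (auto simp: power_int_def power_inverse)
    then show ?thesis by (rule finite_subset) (rule f, use False assms in simp)
  qed
qed

lemma admissible_nonvanishing: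
  assumes g: "admissible m r \<phi>" and t: "Im \<tau> > 0"
  shows "nonvanishing m r (topspace (torus m r)) (\<lambda>z. theta_mult \<tau> (\<phi> z))"
  unfolding nonvanishing_def
proof (intro allI impI, elim conjE)
  fix W assume W: "openin (torus m r) W" "W \<noteq> {}"
  then obtain z where z: "z \<in> W" "z \<in> topspace (torus m r)" using openin_subset by blast
  obtain c e where c: "c \<in> coords m r" "e \<noteq> 0"
    "\<And>z t. z \<in> topspace (torus m r) \<Longrightarrow> t \<noteq> 0 \<Longrightarrow> \<phi> (z(c := t)) = \<phi> z * (t / z c) powi e"
    using g unfolding admissible_def by metis
  obtain S where S: "open S" "z c \<in> S" "0 \<notin> S" "\<And>t. t \<in> S \<Longrightarrow> z(c := t) \<in> W"
    using slice_open[OF W(1) z(1) c(1)] by metis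
  have z0: "z c \<noteq> 0" using S by metis
  have p0: "\<phi> z \<noteq> 0" using g z by (auto simp: admissible_def)
  let ?B = "\<Union>k::int. (\<lambda>s. s * z c) ` {s. s powi e = nome \<tau> powi k / \<phi> z}"
  have "countable ?B" by (rule countable_UN[OF countableI_type], rule countable_image, rule countable_finite, rule countable_root[OF c(2)])
  moreover obtain \<epsilon> where "\<epsilon> > 0" "ball (z c) \<epsilon> \<subseteq> S" using S(1,2) open_contains_ball by blast
  ultimately have "\<not> S \<subseteq> ?B"
    using uncountable_ball countable_subset subset_trans by metis
  then obtain t where t: "t \<in> S" "t \<notin> ?B" by blast
  have t0: "t \<noteq> 0" using t S by auto
  have "\<phi> (z(c := t)) \<notin> range (\<lambda>k::int. nome \<tau> powi k)"
  proof
    assume "\<phi> (z(c := t)) \<in> range (\<lambda>k::int. nome \<tau> powi k)"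
    then obtain k :: int where "\<phi> z * (t / z c) powi e = nome \<tau> powi k" using c(3)[OF z(2) t0] by auto
    then have "(t / z c) powi e = nome \<tau> powi k / \<phi> z" using p0 by (simp add: field_simps)
    then have "t \<in> ?B" using z0 by (auto intro!: exI[of _ k] image_eqI[of _ _ "t / z c"])
    then show False using t by simp
  qed
  moreover have "\<phi> (z(c := t)) \<noteq> 0"
    using g S(4)[OF t(1)] openin_subset[OF W(1)] by (auto simp: admissible_def)
  ultimately have "theta_mult \<tau> (\<phi> (z(c := t))) \<noteq> 0" using theta_mult_zero[OF \<open>Im \<tau> > 0\<close>] by blast
  then show "\<exists>z\<in>W. theta_mult \<tau> (\<phi> z) \<noteq> 0" using S(4)[OF t(1)] by blast
qed

lemma mero_delta:
  assumes g: "admissible m r \<phi>" "admissible m r \<psi>" and t: "Im \<tau> > 0"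
  shows "mero m r (\<lambda>z. delta \<tau> (\<phi> z) (\<psi> z))"
proof -
  let ?T = "topspace (torus m r)"
  define K where "K = deriv (theta \<tau>) 0 * \<i> / exp (2 * of_real pi * \<i> * \<tau> / 8)"
  have h: "holo_on m r ?T (\<lambda>z. theta_mult \<tau> (f z))" if "holo_on m r ?T f" "\<forall>z\<in>?T. f z \<noteq> 0" for f
    using that by (intro holo_comp[OF _ _ theta_mult_holomorphic[OF t]]) auto
  have 1: "holo_on m r ?T (\<lambda>z. K * theta_mult \<tau> (\<phi> z * \<psi> z))"
    using g by (intro holo_mult holo_const h) (auto simp: admissible_def)
  have h2: "holo_on m r ?T (\<lambda>z. theta_mult \<tau> (\<phi> z))" "holo_on m r ?T (\<lambda>z. theta_mult \<tau> (\<psi> z))"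
    using g by (auto simp: admissible_def intro!: h)
  have n: "nonvanishing m r ?T (\<lambda>z. theta_mult \<tau> (\<phi> z) * theta_mult \<tau> (\<psi> z))"
    by (intro nonvanishing_mult admissible_nonvanishing h2 g t) auto
  have e: "delta \<tau> (\<phi> z) (\<psi> z) = K * theta_mult \<tau> (\<phi> z * \<psi> z) / (theta_mult \<tau> (\<phi> z) * theta_mult \<tau> (\<psi> z))" if "z \<in> ?T" for z
    using g that by (simp add: delta_theta_mult[OF t] admissible_def K_def)
  show ?thesis unfolding mero_nonvanishing
    by (intro ballI, rule exI[of _ ?T], rule exI[of _ "\<lambda>z. K * theta_mult \<tau> (\<phi> z * \<psi> z)"],
        rule exI[of _ "\<lambda>z. theta_mult \<tau> (\<phi> z) * theta_mult \<tau> (\<psi> z)"])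
       (use 1 holo_mult[OF h2] n e in simp)
qed

lemma admissible_coord: "c \<in> coords m r \<Longrightarrow> admissible m r (\<lambda>z. z c)"
  unfolding admissible_def
  by (intro conjI holo_coord bexI[of _ c] exI[of _ 1]) (auto simp: topspace_torus PiE_def Pi_def)

lemma holo_powi: 
  assumes "c \<in> coords m r"
  shows "holo_on m r (topspace (torus m r)) (\<lambda>z. z c powi e)"
  by (rule holo_comp[OF holo_coord, where p = "\<lambda>t. t powi e" and S = "- {0}"])
     (use assms in \<open>auto simp: topspace_torus PiE_def Pi_def intro!: holomorphic_intros\<close>)

lemma admissible_ratio: 
  assumes "c \<in> coords m r" "c' \<in> coords m r" "c \<noteq> c'"
  shows "admissible m r (\<lambda>z. z c / z c')"
  unfolding admissible_def
proof (intro conjI bexI[of _ c] exI[of _ 1])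
  have "holo_on m r (topspace (torus m r)) (\<lambda>z. z c * z c' powi (-1))"
    using assms by (intro holo_mult holo_coord holo_powi)
  then show "holo_on m r (topspace (torus m r)) (\<lambda>z. z c / z c')"
    by (simp add: power_int_minus field_simps)
qed (use assms in \<open>auto simp: topspace_torus PiE_def Pi_def\<close>)

lemma admissible_character:
  assumes "character r \<kappa>" "\<not> trivial_mod_q \<tau> m r \<kappa>"
  shows "admissible m r \<kappa>"
proof -
  obtain a :: "nat \<Rightarrow> int" and b where k: "\<kappa> = (\<lambda>z. (\<Prod>j = 1..r. z (cMu j) powi a j) * z cH powi b)"
    using assms(1) by (auto simp: character_def)
  have mem: "cH \<in> coords m r" "\<And>j. j \<in> {1..r} \<Longrightarrow> cMu j \<in> coords m r" by (auto simp: coords_def)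
  have nz: "z cH \<noteq> 0" "\<And>j. j \<in> {1..r} \<Longrightarrow> z (cMu j) \<noteq> 0" if "z \<in> topspace (torus m r)" for z
    using that mem by (auto simp: topspace_torus PiE_def Pi_def simp del: atLeastAtMost_iff)
  have "\<exists>c\<in>coords m r. \<exists>e::int. e \<noteq> 0 \<and> (\<forall>z\<in>topspace (torus m r). \<forall>t. t \<noteq> 0 \<longrightarrow> \<kappa> (z(c := t)) = \<kappa> z * (t / z c) powi e)"
  proof (cases "b = 0")
    case False
    show ?thesis
      by (intro bexI[of _ cH] exI[of _ b] conjI ballI allI impI)
         (use mem False nz in \<open>auto simp: k power_int_divide_distrib\<close>)
  next
    case b: True
    have "\<exists>j\<in>{1..r}. a j \<noteq> 0"
    proof (rule ccontr)
      assume "\<not> ?thesis"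
      then have "\<kappa> z = nome \<tau> powi 0" for z using b by (simp add: k)
      then show False using assms(2) unfolding trivial_mod_q_def by blast
    qed
    then obtain j where j: "j \<in> {1..r}" "a j \<noteq> 0" by auto
    show ?thesis
    proof (intro bexI[of _ "cMu j"] exI[of _ "a j"] conjI ballI allI impI)
      fix z t assume z: "z \<in> topspace (torus m r)" and t: "t \<noteq> (0::complex)"
      have rest: "(\<Prod>i\<in>{1..r} - {j}. (z(cMu j := t)) (cMu i) powi a i) = (\<Prod>i\<in>{1..r} - {j}. z (cMu i) powi a i)"
        by (intro prod.cong) auto
      have rem: "\<kappa> y = y (cMu j) powi a j * (\<Prod>i\<in>{1..r} - {j}. y (cMu i) powi a i)" for y
        using j(1) unfolding k b by (subst prod.remove[of "{1..r}" j]) auto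
      show "\<kappa> (z(cMu j := t)) = \<kappa> z * (t / z (cMu j)) powi a j"
        using nz(2)[OF z j(1)] unfolding rem[of "z(cMu j := t)"] rest rem[of z]
        by (simp add: power_int_divide_distrib)
    qed (use j mem in auto)
  qed
  moreover have "holo_on m r (topspace (torus m r)) \<kappa>"
    unfolding k using mem by (intro holo_mult holo_prod holo_powi) auto
  moreover have "\<forall>z\<in>topspace (torus m r). \<kappa> z \<noteq> 0"
    using nz by (auto simp: k)
  ultimately show ?thesis by (simp add: admissible_def)
qed

lemma mero_frakC:
  assumes "Im \<tau> > 0" "1 \<le> i" "i < m" "character r \<kappa>" "\<not> trivial_mod_q \<tau> m r \<kappa>" "mero m r f"
  shows "mero m r (frakC \<tau> i \<kappa> f)"
  unfolding frakC_def
  using assms cX_coords[OF assms(2,3)]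
  by (intro mero_op mero_delta mero_swap admissible_ratio admissible_coord admissible_character) (auto simp: coords_def)

end

theory Submission
  imports Defs
begin

text \<open>
  Up to elementary factors, \<open>\<delta>(x, y) = \<theta>(x y) / (\<theta>(x) \<theta>(y))\<close> for the single-valued function
  \<open>\<theta>\<close> on \<open>\<complex>\<^sup>*\<close> called \<open>theta_mult\<close>. Expanding both sides of each relation and comparing
  coefficients of the permuted copies of \<open>f\<close> leaves identities between values of \<open>\<delta>\<close>: the Fay
  identity for the simple reflections, and for the identity permutation consequences of
  \<open>\<delta>(x, y) \<delta>(x, 1 / y) + \<delta>(1 / x, h) \<delta>(x, h) = \<delta>(h, y) \<delta>(h, 1 / y)\<close>. All of them are instances
  of the Weierstrass three-term relation for \<open>\<theta>\<close>. That relation holds because the ratio of two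
  functions on \<open>\<complex>\<^sup>*\<close> with the same multipliers under \<open>z \<mapsto> q z\<close> is constant as soon as it has
  no poles. The relations between operators then hold on the dense open set where the
  arguments of all the occurring \<open>\<delta>\<close> avoid \<open>q\<^sup>\<int>\<close>.
\<close>

section \<open>Quasi-periodic functions on the punctured plane\<close>

text \<open>This transports zeros, double zeros and function values along an orbit of multiplication
  by \<open>q\<close>. The induction runs in both directions because negative powers occur.\<close>

lemma multiplicative_periodicity:
  fixes q z :: complex and P :: "complex \<Rightarrow> bool"
  assumes "q \<noteq> 0" "z \<noteq> 0" and per: "\<And>z. z \<noteq> 0 \<Longrightarrow> P (q * z) \<longleftrightarrow> P z"
  shows "P (q powi k * z) \<longleftrightarrow> P z"
proof (induction k rule: int_induct[where k = 0])
  case (step1 i)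
  then show ?case
    using per[of "q powi i * z"] assms(1,2) by (simp add: power_int_add_1' mult.assoc)
next
  case (step2 i)
  have "q * (q powi (i - 1) * z) = q powi i * z"
    using assms(1) by (simp add: power_int_diff)
  then show ?case
    using step2.IH per[of "q powi (i - 1) * z"] assms(1,2) by (metis mult_eq_0_iff power_int_not_zero)
qed simp

text \<open>The exponent is minus the floor of \<open>L\<close>, the logarithm of |z| to base |q|;
  the modulus that remains is |q| raised to the fractional part of \<open>L\<close>.\<close>

lemma fundamental_annulus:
  fixes q z :: complex
  assumes q: "q \<noteq> 0" "norm q < 1" and z: "z \<noteq> 0"
  obtains k :: int where "norm q \<le> norm (q powi k * z)" "norm (q powi k * z) \<le> 1"
proof -
  define L where "L = ln (norm z) / ln (norm q)"
  have neg: "ln (norm q) < 0" using q by simp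
  have "norm (q powi (- \<lfloor>L\<rfloor>) * z) = norm q powr frac L"
  proof -
    have "norm z = norm q powr L"
      using q z neg by (simp add: L_def powr_def)
    moreover have "norm q powr frac L = norm q powr L * norm q powi (- \<lfloor>L\<rfloor>)"
      using q by (simp add: frac_def powr_diff powr_real_of_int' power_int_minus divide_inverse)
    ultimately show ?thesis
      by (simp only: norm_mult norm_power_int mult.commute)
  qed
  moreover have "norm q \<le> norm q powr frac L"
    using powr_mono'[of "frac L" 1 "norm q"] q frac_lt_1[of L] by simp
  moreover have "norm q powr frac L \<le> 1"
    using powr_mono'[of 0 "frac L" "norm q"] q by simp
  ultimately show thesis using that by metis
qed

text \<open>The singularities are removable, with the value of l'Hospital's rule. Near a zero
  \<open>a\<close> of \<open>g\<close> both functions are divided by \<open>z - a\<close>; the new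
  denominator takes the nonzero value \<open>deriv g a\<close> at \<open>a\<close>.\<close>

lemma holomorphic_on_quotient_simple_zeros:
  fixes f g :: "complex \<Rightarrow> complex"
  assumes f: "f holomorphic_on S" and g: "g holomorphic_on S" and S: "open S"
    and zeros: "\<And>z. z \<in> S \<Longrightarrow> g z = 0 \<Longrightarrow> f z = 0 \<and> deriv g z \<noteq> 0"
  shows "(\<lambda>z. if g z = 0 then deriv f z / deriv g z else f z / g z) holomorphic_on S"
    (is "?h holomorphic_on S")
proof -
  have "?h field_differentiable (at a)" if a: "a \<in> S" for a
  proof (cases "g a = 0")
    case False
    have "isCont g a"
      using g S a by (simp add: holomorphic_on_imp_differentiable_at field_differentiable_imp_continuous_at)
    then have "\<forall>\<^sub>F z in nhds a. g z \<noteq> 0"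
      using False tendsto_imp_eventually_ne[of g "g a" "at a" 0]
      by (simp add: isCont_def eventually_nhds_conv_at)
    then have "\<forall>\<^sub>F z in nhds a. f z / g z = ?h z" by eventually_elim simp
    moreover have "(\<lambda>z. f z / g z) field_differentiable (at a)"
      using f g S a False
      by (intro field_differentiable_divide) (auto simp: holomorphic_on_imp_differentiable_at)
    ultimately show ?thesis
      by (simp add: field_differentiable_def DERIV_cong_ev[OF refl _ refl])
  next
    case True
    define F where "F = (\<lambda>z. if z = a then deriv f a else (f z - f a) / (z - a))"
    define G where "G = (\<lambda>z. if z = a then deriv g a else (g z - g a) / (z - a))"
    have hol: "F holomorphic_on S" "G holomorphic_on S"
      unfolding F_def G_def using f g S by (auto intro: pole_lemma_open)
    have Ga: "G a \<noteq> 0" using zeros[OF a True] by (simp add: G_def)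
    have "isCont G a"
      using hol S a by (simp add: holomorphic_on_imp_differentiable_at field_differentiable_imp_continuous_at)
    then have "\<forall>\<^sub>F z in nhds a. G z \<noteq> 0"
      using Ga tendsto_imp_eventually_ne[of G "G a" "at a" 0]
      by (simp add: isCont_def eventually_nhds_conv_at)
    then have "\<forall>\<^sub>F z in nhds a. F z / G z = ?h z"
      by eventually_elim (use True zeros[OF a True] in \<open>auto simp: F_def G_def split: if_splits\<close>)
    moreover have "(\<lambda>z. F z / G z) field_differentiable (at a)"
      using hol S a Ga
      by (intro field_differentiable_divide) (auto simp: holomorphic_on_imp_differentiable_at)
    ultimately show ?thesis
      by (simp add: field_differentiable_def DERIV_cong_ev[OF refl _ refl])
  qed
  then show ?thesis
    using field_differentiable_at_within holomorphic_on_def by blast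
qed

text \<open>All values are already taken on a compact annulus, so \<open>h\<close> is bounded.
  Composition with \<open>exp\<close> gives a bounded entire function, and Liouville's theorem
  applies.\<close>

lemma holomorphic_multiplicatively_periodic_constant:
  fixes h :: "complex \<Rightarrow> complex"
  assumes q: "q \<noteq> 0" "norm q < 1" and h: "h holomorphic_on - {0}"
    and per: "\<And>z. z \<noteq> 0 \<Longrightarrow> h (q * z) = h z"
  shows "\<exists>C. \<forall>z. z \<noteq> 0 \<longrightarrow> h z = C"
proof -
  define A :: "complex set" where "A = cball 0 1 - ball 0 (norm q)"
  have "compact A" unfolding A_def by (intro compact_diff) auto
  moreover have "A \<subseteq> - {0}" using q by (auto simp: A_def)
  ultimately have bA: "bounded (h ` A)"
    using h by (meson compact_continuous_image compact_imp_bounded continuous_on_subset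
        holomorphic_on_imp_continuous_on)
  have "h z \<in> h ` A" if z: "z \<noteq> 0" for z
  proof -
    obtain k :: int where "norm q \<le> norm (q powi k * z)" "norm (q powi k * z) \<le> 1"
      using fundamental_annulus[OF q z] .
    then have "q powi k * z \<in> A" by (simp add: A_def)
    moreover have "h (q powi k * z) = h z"
      using multiplicative_periodicity[of q z "\<lambda>w. h w = h z" k] q z per by simp
    ultimately show ?thesis by (metis image_eqI)
  qed
  then have "bounded (range (\<lambda>t. h (exp t)))"
    by (intro bounded_subset[OF bA]) auto
  moreover have "(\<lambda>t. h (exp t)) holomorphic_on UNIV"
    using holomorphic_on_compose_gen[OF holomorphic_on_exp h, of UNIV] by (simp add: o_def image_subset_iff Compl_eq)
  ultimately obtain C where "h (exp t) = C" for t
    using Liouville_theorem by (metis UNIV_I constant_on_def)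
  then show ?thesis by (metis exp_Ln)
qed

text \<open>The common multiplier cancels in the quotient of \<open>f\<close> by \<open>g\<close>,
  which extends over the simple zeros of \<open>g\<close> and is therefore constant.\<close>

lemma quasi_periodic_proportional:
  fixes f g \<phi> :: "complex \<Rightarrow> complex"
  assumes q: "q \<noteq> 0" "norm q < 1"
    and hol: "f holomorphic_on - {0}" "g holomorphic_on - {0}" "\<phi> holomorphic_on - {0}"
    and \<phi>: "\<And>z. z \<noteq> 0 \<Longrightarrow> \<phi> z \<noteq> 0"
    and f: "\<And>z. z \<noteq> 0 \<Longrightarrow> f (q * z) = \<phi> z * f z"
    and g: "\<And>z. z \<noteq> 0 \<Longrightarrow> g (q * z) = \<phi> z * g z"
    and zeros: "\<And>z. z \<noteq> 0 \<Longrightarrow> g z = 0 \<Longrightarrow> f z = 0 \<and> deriv g z \<noteq> 0"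
  shows "\<exists>C. \<forall>z. z \<noteq> 0 \<longrightarrow> f z = C * g z"
proof -
  define h where "h = (\<lambda>z. if g z = 0 then deriv f z / deriv g z else f z / g z)"
  \<comment> \<open>At a zero of \<open>k\<close> the product rule loses its term with the
    derivative of \<open>\<phi>\<close>, so derivatives transform with the same multiplier. Hence
    the values filled in at the zeros are invariant too.\<close>
  have d: "q * deriv k (q * z) = \<phi> z * deriv k z"
    if k: "k holomorphic_on - {0}" "\<And>z. z \<noteq> 0 \<Longrightarrow> k (q * z) = \<phi> z * k z" and z: "z \<noteq> 0" "k z = 0"
    for k z
  proof -
    have D: "(F has_field_derivative deriv F w) (at w)"
      if "F holomorphic_on - {0}" "w \<noteq> 0" for F w
      using that by (intro holomorphic_derivI[of F "- {0}"]) auto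
    have "((\<lambda>w. k (q * w)) has_field_derivative deriv k (q * z) * q) (at z)"
      by (rule DERIV_chain2[OF D]) (use k q z in \<open>auto intro!: derivative_eq_intros\<close>)
    then have "((\<lambda>w. \<phi> w * k w) has_field_derivative deriv k (q * z) * q) (at z)"
      by (rule has_field_derivative_transform_within_open[of _ _ _ "- {0}"]) (use k z in auto)
    moreover have "((\<lambda>w. \<phi> w * k w) has_field_derivative \<phi> z * deriv k z) (at z)"
      using DERIV_mult[OF D[OF hol(3) z(1)] D[OF k(1) z(1)]] z by (simp add: mult.commute)
    ultimately show ?thesis by (metis DERIV_unique mult.commute)
  qed
  have "h holomorphic_on - {0}"
    unfolding h_def using hol zeros by (intro holomorphic_on_quotient_simple_zeros) auto
  moreover have "h (q * z) = h z" if z: "z \<noteq> 0" for z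
  proof (cases "g z = 0")
    case True
    have "q * deriv f (q * z) = \<phi> z * deriv f z" "q * deriv g (q * z) = \<phi> z * deriv g z"
      using d[OF hol(1) f z] d[OF hol(2) g z] zeros[OF z True] True by auto
    then have "deriv f (q * z) / deriv g (q * z) = deriv f z / deriv g z"
      using q \<phi>[OF z] by (metis mult_divide_mult_cancel_left)
    then show ?thesis using True g[OF z] by (simp add: h_def)
  next
    case False
    then show ?thesis using f[OF z] g[OF z] \<phi>[OF z] by (simp add: h_def)
  qed
  ultimately obtain C where C: "\<And>z. z \<noteq> 0 \<Longrightarrow> h z = C"
    using holomorphic_multiplicatively_periodic_constant[OF q] by blast
  have "f z = C * g z" if "z \<noteq> 0" for z
    using C[OF that] zeros[OF that] by (auto simp: h_def split: if_splits)
  then show ?thesis by blast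
qed

text \<open>A nonzero value would persist on a ball, and a ball is uncountable.\<close>

lemma continuous_zero_off_countable:
  fixes f :: "complex \<Rightarrow> complex"
  assumes "open S" "continuous_on S f" "countable A"
    and zero: "\<And>z. z \<in> S - A \<Longrightarrow> f z = 0" and "z \<in> S"
  shows "f z = 0"
proof (rule ccontr)
  assume "f z \<noteq> 0"
  have "open (S \<inter> f -` (- {0}))"
    using assms(1,2) by (intro continuous_open_preimage) auto
  then obtain e where e: "e > 0" "ball z e \<subseteq> S \<inter> f -` (- {0})"
    using \<open>f z \<noteq> 0\<close> \<open>z \<in> S\<close> by (elim openE[of _ z]) auto
  then have "ball z e \<subseteq> A" using zero by auto
  then show False using uncountable_ball[OF e(1)] assms(3) countable_subset by blast
qed

section \<open>The three-term relation\<close>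

lemma euler_fn_shift:
  assumes "norm q < 1"
  shows "euler_fn q w = (1 - q * w) * euler_fn q (q * w)"
  using has_prod_unique[OF has_prod_ignore_initial_segment'[OF euler_fn_convergent[OF assms, of w], of 1]]
  by (simp add: euler_fn_def mult_ac)

lemma theta_mult_inverse: "z \<noteq> 0 \<Longrightarrow> theta_mult \<tau> (1 / z) = - theta_mult \<tau> z / z"
  by (simp add: theta_mult_def field_simps)

lemma nome_nonzero: "nome \<tau> \<noteq> 0"
  by (simp add: nome_def)

lemma theta_mult_1: "theta_mult \<tau> 1 = 0"
  by (simp add: theta_mult_def)

lemma delta_commute: "delta \<tau> x y = delta \<tau> y x"
  by (simp add: delta_def kronF_def add.commute mult.commute)

lemma theta_mult_divide_swap:
  assumes "x \<noteq> 0" "y \<noteq> 0"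
  shows "theta_mult \<tau> (x / y) = - theta_mult \<tau> (y / x) * (x / y)"
  using theta_mult_inverse[of "y / x" \<tau>] assms by simp

context
  fixes \<tau> :: complex
  assumes \<tau>: "Im \<tau> > 0"
begin

text \<open>Only one factor moves in each product: \<open>q z - 1\<close> completes
  \<open>euler_fn\<close> at \<open>q z\<close> to minus its value at \<open>z\<close>, and the new
  factor \<open>1 - 1 / z\<close> recreates \<open>z - 1\<close> up to division by
  \<open>z\<close>.\<close>

lemma theta_mult_nome:
  assumes "z \<noteq> 0"
  shows "theta_mult \<tau> (nome \<tau> * z) = - theta_mult \<tau> z / z"
proof -
  let ?q = "nome \<tau>"
  define E where "E = euler_fn ?q"
  note shift = euler_fn_shift[OF nome_less_1[OF \<tau>], folded E_def]
  have "E (1 / (?q * z)) = (1 - 1 / z) * E (1 / z)"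
    using shift[of "1 / (?q * z)"] nome_nonzero by simp
  moreover have "(?q * z - 1) * E (?q * z) = - E z"
    using shift[of z] by (simp add: algebra_simps)
  ultimately have "(?q * z - 1) * (E 1 * E (?q * z) * E (1 / (?q * z))) =
      - E z * (E 1 * ((1 - 1 / z) * E (1 / z)))"
    by (metis mult.assoc mult.left_commute)
  then show ?thesis
    using assms unfolding theta_mult_def E_def[symmetric] by (simp add: field_simps)
qed

lemma DERIV_theta_mult:
  "z \<noteq> 0 \<Longrightarrow> (theta_mult \<tau> has_field_derivative deriv (theta_mult \<tau>) z) (at z)"
  using theta_mult_holomorphic[OF \<tau>] by (intro holomorphic_derivI[of _ "- {0}"]) auto

lemma euler_fn_1_nonzero: "euler_fn (nome \<tau>) 1 \<noteq> 0"
proof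
  assume "euler_fn (nome \<tau>) 1 = 0"
  then obtain k where "nome \<tau> ^ Suc k = 1"
    using euler_fn_zero[OF nome_less_1[OF \<tau>]] by (metis mult.right_neutral)
  then have "norm (nome \<tau>) ^ Suc k = 1"
    by (metis norm_one norm_power)
  then show False
    using power_less_one_iff[of "norm (nome \<tau>)" "Suc k"] nome_less_1[OF \<tau>] by simp
qed

lemma deriv_theta_mult_1: "deriv (theta_mult \<tau>) 1 = euler_fn (nome \<tau>) 1 ^ 3"
proof -
  let ?E = "euler_fn (nome \<tau>)"
  define G where "G = (\<lambda>z. ?E 1 * ?E z * ?E (1 / z))"
  note q = nome_less_1[OF \<tau>]
  have "G holomorphic_on - {0}"
    unfolding G_def
    by (intro holomorphic_intros holomorphic_on_compose_gen[OF _ euler_fn_holomorphic[OF q], unfolded o_def]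
        holomorphic_on_subset[OF euler_fn_holomorphic[OF q]]) auto
  then have "(G has_field_derivative deriv G 1) (at 1)"
    by (intro holomorphic_derivI[of _ "- {0}"]) auto
  then have "((\<lambda>z. (z - 1) * G z) has_field_derivative G 1) (at 1)"
    by (auto intro!: derivative_eq_intros)
  moreover have "(\<lambda>z. (z - 1) * G z) = theta_mult \<tau>"
    by (simp add: G_def theta_mult_def fun_eq_iff)
  ultimately show ?thesis
    by (simp add: DERIV_imp_deriv G_def power3_eq_cube)
qed

text \<open>Having a double zero, the predicate \<open>P\<close>, is invariant under multiplication
  by the nome. All zeros are powers of the nome, so the question reduces to \<open>z = 1\<close>,
  where the derivative is a nonzero cube.\<close>

lemma theta_mult_simple_zero:
  assumes "z \<noteq> 0" "theta_mult \<tau> z = 0"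
  shows "deriv (theta_mult \<tau>) z \<noteq> 0"
proof -
  let ?q = "nome \<tau>" and ?T = "theta_mult \<tau>"
  define P where "P = (\<lambda>z. ?T z = 0 \<and> deriv ?T z = 0)"
  have "P (?q * z) \<longleftrightarrow> P z" if z: "z \<noteq> 0" for z
  proof -
    have "((\<lambda>w. ?T (?q * w)) has_field_derivative deriv ?T (?q * z) * ?q) (at z)"
      by (rule DERIV_chain2[OF DERIV_theta_mult])
         (use z nome_nonzero in \<open>auto intro!: derivative_eq_intros\<close>)
    then have "((\<lambda>w. - ?T w / w) has_field_derivative deriv ?T (?q * z) * ?q) (at z)"
      by (rule has_field_derivative_transform_within_open[of _ _ _ "- {0}"])
         (use z theta_mult_nome in auto)
    moreover have "((\<lambda>w. - ?T w / w) has_field_derivative (?T z - deriv ?T z * z) / (z * z)) (at z)"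
      using DERIV_theta_mult[OF z] z by (auto intro!: derivative_eq_intros simp: field_simps)
    ultimately have "deriv ?T (?q * z) * ?q = (?T z - deriv ?T z * z) / (z * z)"
      by (rule DERIV_unique)
    then show ?thesis
      using z nome_nonzero[of \<tau>] theta_mult_nome[OF z] by (auto simp: P_def)
  qed
  moreover obtain k :: int where "z = ?q powi k"
    using theta_mult_zero[OF \<tau> assms(2,1)] by auto
  ultimately have "P z \<longleftrightarrow> P 1"
    using multiplicative_periodicity[of ?q 1 P k] nome_nonzero by simp
  then show ?thesis
    using assms(2) deriv_theta_mult_1 euler_fn_1_nonzero by (auto simp: P_def)
qed

text \<open>In the variable \<open>y\<close>, the difference \<open>f\<close> of the two sides has the same multipliers as
  \<open>g y = theta_mult \<tau> (y * a) * theta_mult \<tau> (y * b)\<close> and vanishes at the zeros of \<open>g\<close>, so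
  \<open>f\<close> is a multiple of \<open>g\<close>; but \<open>f\<close> also vanishes at \<open>y = 1\<close>.\<close>

lemma theta_mult_three_term_generic:
  assumes nz: "x \<noteq> 0" "y \<noteq> 0" "a \<noteq> 0" "b \<noteq> 0"
    and T: "theta_mult \<tau> a \<noteq> 0" "theta_mult \<tau> b \<noteq> 0"
    and ab: "a / b \<notin> range (\<lambda>k::int. nome \<tau> powi k)"
  shows "theta_mult \<tau> (x * a) * theta_mult \<tau> (x * b) * theta_mult \<tau> (y * a * b) * theta_mult \<tau> y
       - theta_mult \<tau> (y * a) * theta_mult \<tau> (y * b) * theta_mult \<tau> (x * a * b) * theta_mult \<tau> x
       + y * theta_mult \<tau> (x * y * a * b) * theta_mult \<tau> (x / y) * theta_mult \<tau> a * theta_mult \<tau> b = 0"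
proof -
  let ?q = "nome \<tau>" and ?T = "theta_mult \<tau>"
  define f where "f = (\<lambda>y. ?T (x * a) * ?T (x * b) * ?T (y * a * b) * ?T y
       - ?T (y * a) * ?T (y * b) * ?T (x * a * b) * ?T x
       + y * ?T (x * y * a * b) * ?T (x / y) * ?T a * ?T b)"
  define g where "g = (\<lambda>y. ?T (y * a) * ?T (y * b))"
  \<comment> \<open>The theta factors of \<open>g\<close> contribute \<open>- 1 / (y * a)\<close>
    and \<open>- 1 / (y * b)\<close>, whose product is this multiplier.\<close>
  define \<phi> where "\<phi> = (\<lambda>y. 1 / (y * y * a * b))"
  have q: "?q \<noteq> 0" "norm ?q < 1" using nome_nonzero nome_less_1[OF \<tau>] by auto
  have shift: "?T (?q * z * c) = - ?T (z * c) / (z * c)" "?T (?q * z) = - ?T z / z"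
    if "z \<noteq> 0" "c \<noteq> 0" for z c
    using theta_mult_nome[of "z * c"] theta_mult_nome[of z] that by (simp_all add: mult.assoc)
  \<comment> \<open>The argument \<open>x / y\<close> moves the opposite way when \<open>y\<close>
    is multiplied by the nome, which calls for the inverse shift.\<close>
  have unshift: "?T (z / ?q) = - ?T z * z / ?q" if "z \<noteq> 0" for z
    using theta_mult_nome[of "z / ?q"] that q by (simp add: field_simps)
  have gper: "g (?q * z) = \<phi> z * g z" if z: "z \<noteq> 0" for z
    using z nz by (simp add: g_def \<phi>_def shift)
  have fper: "f (?q * z) = \<phi> z * f z" if z: "z \<noteq> 0" for z
  proof -
    have 1: "?T (?q * z * a * b) = - ?T (z * a * b) / (z * a * b)"
      using shift(1)[of z "a * b"] z nz by (simp add: mult.assoc)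
    have 2: "?T (x * (?q * z) * a * b) = - ?T (x * z * a * b) / (x * z * a * b)"
      using shift(1)[of z "x * a * b"] z nz by (simp add: mult_ac)
    have 3: "?T (x / (?q * z)) = - ?T (x / z) * (x / z) / ?q"
      using unshift[of "x / z"] z nz by (simp add: mult.commute)
    show ?thesis
      unfolding f_def \<phi>_def 1 2 3 shift(1)[OF z nz(3)] shift(1)[OF z nz(4)] shift(2)[OF z z]
      using z nz q by (simp add: field_simps)
  qed
  have compose: "(\<lambda>y. ?T (p y)) holomorphic_on - {0}"
    if "p holomorphic_on - {0}" "\<And>y. y \<noteq> 0 \<Longrightarrow> p y \<noteq> 0" for p
    using holomorphic_on_compose_gen[OF that(1) theta_mult_holomorphic[OF \<tau>]] that(2)
    by (simp add: o_def image_subset_iff Compl_eq)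
  have hol: "f holomorphic_on - {0}" "g holomorphic_on - {0}" "\<phi> holomorphic_on - {0}"
    unfolding f_def g_def \<phi>_def using nz by (auto intro!: holomorphic_intros compose)
  \<comment> \<open>At \<open>y = 1 / a\<close> the second product contains the zero at 1, and the
    other two cancel by inversion; likewise at \<open>1 / b\<close>.\<close>
  have zero_a: "f (1 / a) = 0" and zero_b: "f (1 / b) = 0"
    using nz by (simp_all add: f_def theta_mult_inverse theta_mult_1)
  have zeros: "f z = 0 \<and> deriv g z \<noteq> 0" if z: "z \<noteq> 0" "g z = 0" for z
  proof -
    have root: "f z = 0" if c: "c \<noteq> 0" "f (1 / c) = 0" "?T (z * c) = 0" for c
    proof -
      obtain k :: int where "z * c = ?q powi k"
        using theta_mult_zero[OF \<tau> c(3)] z c by auto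
      then have "z = ?q powi k * (1 / c)" using c by (simp add: field_simps)
      then show ?thesis
        using multiplicative_periodicity[of ?q "1 / c" "\<lambda>w. f w = 0" k] q c fper nz
        by (simp add: \<phi>_def)
    qed
    have D: "(g has_field_derivative
        (deriv ?T (z * a) * a * ?T (z * b) + deriv ?T (z * b) * b * ?T (z * a))) (at z)"
    proof -
      have "((\<lambda>y. ?T (y * c)) has_field_derivative deriv ?T (z * c) * c) (at z)" if "c \<noteq> 0" for c
        by (rule DERIV_chain2[OF DERIV_theta_mult]) (use z that in \<open>auto intro!: derivative_eq_intros\<close>)
      from DERIV_mult[OF this[OF nz(3)] this[OF nz(4)]] show ?thesis by (simp add: g_def)
    qed
    \<comment> \<open>A common zero of both factors would make \<open>a / b\<close> a power of the
      nome; since it cannot occur, the zeros of \<open>g\<close> are simple.\<close>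
    have disj: "?T (z * a) \<noteq> 0 \<or> ?T (z * b) \<noteq> 0"
    proof (rule ccontr)
      assume "\<not> ?thesis"
      then obtain j k :: int where "z * a = ?q powi j" "z * b = ?q powi k"
        using theta_mult_zero[OF \<tau>] z nz by (metis imageE mult_eq_0_iff)
      then have "a / b = ?q powi (j - k)"
        using z q by (simp add: power_int_diff) (metis mult_divide_mult_cancel_left)
      then show False using ab by blast
    qed
    consider "?T (z * a) = 0" "?T (z * b) \<noteq> 0" | "?T (z * b) = 0" "?T (z * a) \<noteq> 0"
      using z disj by (auto simp: g_def)
    then show ?thesis
    proof cases
      case 1
      then show ?thesis
        using root[OF nz(3) zero_a] DERIV_imp_deriv[OF D] theta_mult_simple_zero[of "z * a"] nz z by simp
    next
      case 2
      then show ?thesis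
        using root[OF nz(4) zero_b] DERIV_imp_deriv[OF D] theta_mult_simple_zero[of "z * b"] nz z by simp
    qed
  qed
  have "\<phi> z \<noteq> 0" if "z \<noteq> 0" for z using that nz by (simp add: \<phi>_def)
  then obtain C where C: "\<And>z. z \<noteq> 0 \<Longrightarrow> f z = C * g z"
    using quasi_periodic_proportional[OF q hol _ fper gper zeros] by blast
  have "f 1 = 0" by (simp add: f_def theta_mult_1)
  \<comment> \<open>Here \<open>g 1\<close> is the product of the theta values at \<open>a\<close>
    and \<open>b\<close>, nonzero by assumption.\<close>
  then have "C = 0" using C[of 1] T by (simp add: g_def)
  then show ?thesis using C[OF nz(2)] by (simp add: f_def)
qed

text \<open>The generic restrictions exclude only countably many values. Continuity removes them
  first in \<open>a\<close>, with \<open>b\<close> generic, and then in \<open>b\<close>.\<close>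

lemma theta_mult_three_term:
  assumes nz: "x \<noteq> 0" "y \<noteq> 0" "a \<noteq> 0" "b \<noteq> 0"
  shows "theta_mult \<tau> (x * a) * theta_mult \<tau> (x * b) * theta_mult \<tau> (y * a * b) * theta_mult \<tau> y
       - theta_mult \<tau> (y * a) * theta_mult \<tau> (y * b) * theta_mult \<tau> (x * a * b) * theta_mult \<tau> x
       + y * theta_mult \<tau> (x * y * a * b) * theta_mult \<tau> (x / y) * theta_mult \<tau> a * theta_mult \<tau> b = 0"
    (is "?f a b = 0")
proof -
  let ?Q = "range (\<lambda>k::int. nome \<tau> powi k)"
  have T: "theta_mult \<tau> c \<noteq> 0" if "c \<noteq> 0" "c \<notin> ?Q" for c
    using theta_mult_zero[OF \<tau> _ that(1)] that(2) by blast
  have compose: "continuous_on (- {0}) (\<lambda>y. theta_mult \<tau> (p y))"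
    if "continuous_on (- {0}) p" "\<And>y. y \<noteq> 0 \<Longrightarrow> p y \<noteq> 0" for p
    using continuous_on_compose2[OF holomorphic_on_imp_continuous_on[OF theta_mult_holomorphic[OF \<tau>]] that(1)]
      that(2) by (simp add: image_subset_iff Compl_eq)
  have Q: "countable ?Q" by simp
  have generic_b: "?f a b = 0" if b: "b \<noteq> 0" "b \<notin> ?Q" for b
  \<comment> \<open>The second set excludes \<open>a\<close> in \<open>b\<close> times a power of
    the nome, that is, \<open>a / b\<close> among these powers.\<close>
  proof (rule continuous_zero_off_countable[of "- {0}" "\<lambda>a. ?f a b" "?Q \<union> (\<lambda>c. c * b) ` ?Q"])
    show "continuous_on (- {0}) (\<lambda>a. ?f a b)"
      using nz b by (auto intro!: continuous_intros compose)
    fix a assume a: "a \<in> - {0} - (?Q \<union> (\<lambda>c. c * b) ` ?Q)"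
    have "a / b \<notin> ?Q"
    proof
      assume "a / b \<in> ?Q"
      then have "a / b * b \<in> (\<lambda>c. c * b) ` ?Q" by blast
      then show False using a b by simp
    qed
    then show "?f a b = 0"
      using a b nz T by (intro theta_mult_three_term_generic) auto
  qed (use nz Q in \<open>auto simp: open_Compl\<close>)
  show ?thesis
  proof (rule continuous_zero_off_countable[of "- {0}" "\<lambda>b. ?f a b" ?Q])
    show "continuous_on (- {0}) (\<lambda>b. ?f a b)"
      using nz by (auto intro!: continuous_intros compose)
  qed (use nz Q generic_b in \<open>auto simp: open_Compl\<close>)
qed

section \<open>Identities for \<open>\<delta>\<close>\<close>

text \<open>The numerator and both denominator factors each change sign under inversion, and the
  monomial factors cancel. This oddness later kills the swapped term in the unitarity
  relation.\<close>

lemma delta_inverse: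
  assumes "x \<noteq> 0" "y \<noteq> 0"
  shows "delta \<tau> (1 / x) (1 / y) = - delta \<tau> x y"
  using assms theta_mult_inverse[of "x * y" \<tau>]
  by (simp add: delta_theta_mult[OF \<tau>] theta_mult_inverse)

lemma delta_fay:
  assumes nz: "p \<noteq> 0" "r \<noteq> 0" "a \<noteq> 0" "b \<noteq> 0"
    and T: "theta_mult \<tau> p \<noteq> 0" "theta_mult \<tau> r \<noteq> 0" "theta_mult \<tau> (p * r) \<noteq> 0"
      "theta_mult \<tau> a \<noteq> 0" "theta_mult \<tau> b \<noteq> 0" "theta_mult \<tau> (a * b) \<noteq> 0"
  shows "delta \<tau> r a * delta \<tau> (p * r) b =
    delta \<tau> r (a * b) * delta \<tau> p b + delta \<tau> (p * r) (a * b) * delta \<tau> (1 / p) a"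
proof -
  let ?T = "theta_mult \<tau>"
  define K where "K = deriv (theta \<tau>) 0 * \<i> / exp (2 * of_real pi * \<i> * \<tau> / 8)"
  have delta: "delta \<tau> z w = K * ?T (z * w) / (?T z * ?T w)" if "z \<noteq> 0" "w \<noteq> 0" for z w
    using delta_theta_mult[OF \<tau> that] by (simp add: K_def)
  \<comment> \<open>In this instance the factor with \<open>y = 1 / a\<close> brings in
    \<open>- 1 / a\<close>; multiplying by \<open>a\<close> clears it.\<close>
  have core: "?T (r * a) * ?T (p * r * b) * ?T (a * b) * ?T p =
      ?T (r * (a * b)) * ?T (p * r) * ?T (p * b) * ?T a
      + a * ?T b * ?T (p / a) * ?T (p * r * (a * b)) * ?T r"
    using theta_mult_three_term[of r "1 / a" "a * b" p] nz
    by (simp add: theta_mult_inverse field_simps)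
  \<comment> \<open>Theta values become free variables, leaving a rational identity. The terms
    \<open>- P / p\<close> and \<open>- g * (a / p)\<close> stand for the theta values at
    \<open>1 / p\<close> and \<open>a / p\<close>.\<close>
  have alg: "K * u / (R * A) * (K * v / (S * B)) =
      K * m / (R * C) * (K * n / (P * B)) + K * e / (S * C) * (K * (- g * (a / p)) / (- P / p * A))"
    if "u * v * C * P = m * S * n * A + a * B * g * e * R"
      "P \<noteq> 0" "R \<noteq> 0" "S \<noteq> 0" "A \<noteq> 0" "B \<noteq> 0" "C \<noteq> 0"
    for K u v m n e g P R S A B C
    using that(2-) nz(1) by (simp add: divide_simps) (use that(1) in algebra)
  show ?thesis
    using alg[OF core T, of K] nz
    by (simp add: delta theta_mult_inverse theta_mult_divide_swap[of a p])
qed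

text \<open>The left side is the coefficient of \<open>f\<close> in the composite of the operators
  for \<open>a\<close> and \<open>1 / a\<close>; the point is that it does not depend on
  \<open>x\<close>.\<close>

lemma delta_unitarity:
  assumes nz: "x \<noteq> 0" "h \<noteq> 0" "a \<noteq> 0"
    and T: "theta_mult \<tau> x \<noteq> 0" "theta_mult \<tau> h \<noteq> 0" "theta_mult \<tau> a \<noteq> 0"
  shows "delta \<tau> x a * delta \<tau> x (1 / a) + delta \<tau> (1 / x) h * delta \<tau> x h =
    delta \<tau> h a * delta \<tau> h (1 / a)"
proof -
  let ?T = "theta_mult \<tau>"
  define K where "K = deriv (theta \<tau>) 0 * \<i> / exp (2 * of_real pi * \<i> * \<tau> / 8)"
  have delta: "delta \<tau> z w = K * ?T (z * w) / (?T z * ?T w)" if "z \<noteq> 0" "w \<noteq> 0" for z w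
    using delta_theta_mult[OF \<tau> that] by (simp add: K_def)
  \<comment> \<open>Dividing \<open>x\<close> and \<open>a\<close> by \<open>h\<close> and using
    \<open>h\<close> for both remaining parameters makes two theta values coincide in each
    product.\<close>
  have core: "h * ?T x * ?T x * ?T (h * a) * ?T (a / h) =
      h * ?T a * ?T a * ?T (x * h) * ?T (x / h) - a * ?T (x * a) * ?T (x / a) * ?T h * ?T h"
    using theta_mult_three_term[of "x / h" "a / h" h h] nz
    by (simp add: field_simps)
  have alg: "K * u / (X * A) * (K * v / (X * (- A / a))) + K * (- w * (h / x)) / (- X / x * H) * (K * y / (X * H)) =
      K * s / (H * A) * (K * (- t * (h / a)) / (H * (- A / a)))"
    if "h * X * X * s * t = h * A * A * y * w - a * u * v * H * H" "X \<noteq> 0" "H \<noteq> 0" "A \<noteq> 0"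
    for K u v w y s t X H A
    using that(2-) nz by (simp add: divide_simps) (use that(1) in algebra)
  show ?thesis
    using alg[OF core T, of K] nz
    by (simp add: delta theta_mult_inverse theta_mult_divide_swap[of h a]
        theta_mult_divide_swap[of h x])
qed

text \<open>Clearing denominators gives the three-term relation itself; on the right the theta value
  at \<open>x * y\<close> cancels between the first and last factors.\<close>

lemma delta_cubic:
  assumes nz: "x \<noteq> 0" "y \<noteq> 0" "a \<noteq> 0" "b \<noteq> 0"
    and T: "theta_mult \<tau> x \<noteq> 0" "theta_mult \<tau> y \<noteq> 0" "theta_mult \<tau> (x * y) \<noteq> 0"
      "theta_mult \<tau> a \<noteq> 0" "theta_mult \<tau> b \<noteq> 0" "theta_mult \<tau> (a * b) \<noteq> 0"
  shows "delta \<tau> x a * delta \<tau> x b * delta \<tau> y (a * b) - delta \<tau> y a * delta \<tau> y b * delta \<tau> x (a * b) =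
    delta \<tau> x y * delta \<tau> x (1 / y) * delta \<tau> (x * y) (a * b)"
proof -
  let ?T = "theta_mult \<tau>"
  define K where "K = deriv (theta \<tau>) 0 * \<i> / exp (2 * of_real pi * \<i> * \<tau> / 8)"
  have delta: "delta \<tau> z w = K * ?T (z * w) / (?T z * ?T w)" if "z \<noteq> 0" "w \<noteq> 0" for z w
    using delta_theta_mult[OF \<tau> that] by (simp add: K_def)
  have core: "?T (x * a) * ?T (x * b) * ?T (y * (a * b)) * ?T y
      - ?T (y * a) * ?T (y * b) * ?T (x * (a * b)) * ?T x
      + y * ?T (x * y * (a * b)) * ?T (x / y) * ?T a * ?T b = 0"
    using theta_mult_three_term[of x y a b] nz by (simp add: mult.assoc)
  have alg: "K * u / (X * A) * (K * v / (X * B)) * (K * w / (Y * C)) -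
      K * u' / (Y * A) * (K * v' / (Y * B)) * (K * w' / (X * C)) =
      K * Z / (X * Y) * (K * s / (X * (- Y / y))) * (K * t / (Z * C))"
    if "u * v * w * Y - u' * v' * w' * X + y * t * s * A * B = 0"
      "X \<noteq> 0" "Y \<noteq> 0" "Z \<noteq> 0" "A \<noteq> 0" "B \<noteq> 0" "C \<noteq> 0"
    for K u v w u' v' w' s t X Y Z A B C
    using that(2-) nz(2) by (simp add: divide_simps) (use that(1) in algebra)
  show ?thesis
    using alg[OF core T, of K] nz
    by (simp add: delta theta_mult_inverse)
qed

text \<open>This compares the coefficients of \<open>f\<close> in the braid relation. Unitarity with
  parameter \<open>y\<close> turns the difference of the two terms in \<open>h\<close> into the
  right side of \<open>delta_cubic\<close>.\<close>

lemma delta_cubic_h: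
  assumes nz: "x \<noteq> 0" "y \<noteq> 0" "h \<noteq> 0" "a \<noteq> 0" "b \<noteq> 0"
    and T: "theta_mult \<tau> x \<noteq> 0" "theta_mult \<tau> y \<noteq> 0" "theta_mult \<tau> (x * y) \<noteq> 0"
      "theta_mult \<tau> h \<noteq> 0"
      "theta_mult \<tau> a \<noteq> 0" "theta_mult \<tau> b \<noteq> 0" "theta_mult \<tau> (a * b) \<noteq> 0"
  shows "delta \<tau> x a * delta \<tau> x b * delta \<tau> y (a * b) + delta \<tau> (1 / x) h * delta \<tau> x h * delta \<tau> (x * y) (a * b) =
    delta \<tau> y a * delta \<tau> y b * delta \<tau> x (a * b) + delta \<tau> (1 / y) h * delta \<tau> y h * delta \<tau> (x * y) (a * b)"
proof -
  have "delta \<tau> x y * delta \<tau> x (1 / y) + delta \<tau> (1 / x) h * delta \<tau> x h = delta \<tau> (1 / y) h * delta \<tau> y h"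
    using delta_unitarity[of x h y] nz T by (simp add: delta_commute[of \<tau> h] mult.commute)
  then show ?thesis
    using delta_cubic[OF nz(1,2,4,5) T(1-3,5-7)] by algebra
qed
end

section \<open>The operators\<close>

text \<open>The points where all listed theta values are nonzero form an open set by continuity. It
  is dense because no product of these values vanishes identically on a nonempty open set.\<close>

lemma mero_eq_generic:
  assumes \<tau>: "Im \<tau> > 0" and fin: "finite \<Phi>" and adm: "\<And>\<phi>. \<phi> \<in> \<Phi> \<Longrightarrow> admissible m r \<phi>"
    and eq: "\<And>z. z \<in> topspace (torus m r) \<Longrightarrow> (\<And>\<phi>. \<phi> \<in> \<Phi> \<Longrightarrow> theta_mult \<tau> (\<phi> z) \<noteq> 0) \<Longrightarrow> F z = G z"
  shows "mero_eq m r F G"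
proof -
  let ?X = "topspace (torus m r)"
  define d where "d = (\<lambda>z. \<Prod>\<phi>\<in>\<Phi>. theta_mult \<tau> (\<phi> z))"
  have single: "holo_on m r ?X (\<lambda>z. theta_mult \<tau> (\<phi> z))" if "\<phi> \<in> \<Phi>" for \<phi>
    using adm[OF that] holo_comp[OF _ subset_refl theta_mult_holomorphic[OF \<tau>], of m r \<phi>]
    by (auto simp: admissible_def)
  \<comment> \<open>Inducting over subsets of \<open>\<Phi>\<close> keeps admissibility and
    holomorphy of each inserted function at hand.\<close>
  have "nonvanishing m r ?X (\<lambda>z. \<Prod>\<phi>\<in>\<Psi>. theta_mult \<tau> (\<phi> z))" if "\<Psi> \<subseteq> \<Phi>" for \<Psi>
    using finite_subset[OF that fin] that
  proof (induction \<Psi> rule: finite_induct)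
    case empty
    then show ?case by (auto simp: nonvanishing_def)
  next
    case (insert \<phi> \<Psi>)
    have "nonvanishing m r ?X (\<lambda>z. theta_mult \<tau> (\<phi> z) * (\<Prod>\<phi>\<in>\<Psi>. theta_mult \<tau> (\<phi> z)))"
      using insert single adm by (intro nonvanishing_mult admissible_nonvanishing \<tau>) auto
    then show ?case using insert by simp
  qed
  then have nonvan: "nonvanishing m r ?X d" by (simp add: d_def)
  have "holo_on m r ?X d"
    unfolding d_def using single by (intro holo_prod) auto
  then have cont: "continuous_map (torus m r) euclidean d"
    by (simp add: holo_on_def)
  define W where "W = {z \<in> ?X. d z \<in> - {0}}"
  have "openin (torus m r) W"
    unfolding W_def by (rule openin_continuous_map_preimage[OF cont]) auto
  moreover have "torus m r closure_of W = ?X"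
    unfolding dense_intersects_open
  proof (intro allI impI, elim conjE)
    fix U assume U: "openin (torus m r) U" "U \<noteq> {}"
    then obtain z where "z \<in> U" "d z \<noteq> 0"
      using nonvan openin_subset unfolding nonvanishing_def by blast
    then show "W \<inter> U \<noteq> {}" using openin_subset[OF U(1)] by (auto simp: W_def)
  qed
  moreover have "F z = G z" if "z \<in> W" for z
    using that fin by (intro eq) (auto simp: W_def d_def)
  ultimately show ?thesis unfolding mero_eq_def by blast
qed

section \<open>Characters on the torus: invariance under swaps, and products\<close>

lemma character_swp: "character r \<kappa> \<Longrightarrow> \<kappa> (swp i z) = \<kappa> z"
  by (auto simp: character_def swp_def)


lemma torus_nonzero: "z \<in> topspace (torus m r) \<Longrightarrow> c \<in> coords m r \<Longrightarrow> z c \<noteq> 0"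
  by (auto simp: topspace_torus)

lemma torus_upd:
  "z \<in> topspace (torus m r) \<Longrightarrow> c \<in> coords m r \<Longrightarrow> t \<noteq> 0 \<Longrightarrow> z(c := t) \<in> topspace (torus m r)"
  by (auto simp: topspace_torus PiE_def extensional_def Pi_def split: if_splits)

text \<open>On the hyperplanes where a coordinate vanishes the product of two characters need not be a
  character, because of \<open>0 powi (- 1) = 0\<close>.\<close>

lemma character_mult_on_torus:
  assumes "character r \<kappa>" "character r \<kappa>'"
  obtains \<kappa>'' :: "point \<Rightarrow> complex"
  where "character r \<kappa>''" "\<And>m z. z \<in> topspace (torus m r) \<Longrightarrow> \<kappa>'' z = \<kappa> z * \<kappa>' z"
proof -
  obtain a b where \<kappa>: "\<kappa> = (\<lambda>z. (\<Prod>j = 1..r. z (cMu j) powi a j) * z cH powi b)"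
    using assms(1) by (auto simp: character_def)
  obtain a' b' where \<kappa>': "\<kappa>' = (\<lambda>z. (\<Prod>j = 1..r. z (cMu j) powi a' j) * z cH powi b')"
    using assms(2) by (auto simp: character_def)
  define \<kappa>'' :: "point \<Rightarrow> complex"
    where "\<kappa>'' = (\<lambda>z. (\<Prod>j = 1..r. z (cMu j) powi (a j + a' j)) * z cH powi (b + b'))"
  have "\<kappa>'' z = \<kappa> z * \<kappa>' z" if z: "z \<in> topspace (torus m r)" for m z
  proof -
    have "z cH powi (b + b') = z cH powi b * z cH powi b'"
      using torus_nonzero[OF z, of cH] by (simp add: coords_def power_int_add)
    moreover have "(\<Prod>j = 1..r. z (cMu j) powi (a j + a' j)) =
        (\<Prod>j = 1..r. z (cMu j) powi a j * z (cMu j) powi a' j)"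
      using torus_nonzero[OF z] by (intro prod.cong) (auto simp: coords_def power_int_add)
    ultimately show ?thesis
      by (simp add: \<kappa> \<kappa>' \<kappa>''_def prod.distrib mult_ac)
  qed
  moreover have "character r \<kappa>''" unfolding \<kappa>''_def character_def
    by (intro exI[of _ "\<lambda>j. a j + a' j"] exI[of _ "b + b'"] refl)
  ultimately show thesis using that by blast
qed

text \<open>On the torus the product agrees with a genuine character, whose nontrivial monomial
  coordinate and exponent carry over; \<open>torus_upd\<close> keeps the modified point in the
  torus.\<close>

lemma admissible_character_mult:
  assumes "character r \<kappa>" "character r \<kappa>'"
    and "admissible m r \<kappa>" "admissible m r \<kappa>'"
    and "\<not> trivial_mod_q \<tau> m r (\<lambda>z. \<kappa> z * \<kappa>' z)"
  shows "admissible m r (\<lambda>z. \<kappa> z * \<kappa>' z)"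
proof -
  obtain \<kappa>'' where \<kappa>'': "character r \<kappa>''"
    and eq: "\<And>z. z \<in> topspace (torus m r) \<Longrightarrow> \<kappa>'' z = \<kappa> z * \<kappa>' z"
    using character_mult_on_torus[OF assms(1,2)] by metis
  then have "\<not> trivial_mod_q \<tau> m r \<kappa>''" using assms(5) by (simp add: trivial_mod_q_def)
  from admissible_character[OF \<kappa>'' this]
  obtain c and e :: int where c: "c \<in> coords m r" "e \<noteq> 0"
    and \<kappa>''_upd: "\<And>z t. z \<in> topspace (torus m r) \<Longrightarrow> t \<noteq> 0 \<Longrightarrow> \<kappa>'' (z(c := t)) = \<kappa>'' z * (t / z c) powi e"
    unfolding admissible_def by blast
  show ?thesis
    unfolding admissible_def
  proof (intro conjI bexI[of _ c] exI[of _ e] ballI allI impI)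
    show "holo_on m r (topspace (torus m r)) (\<lambda>z. \<kappa> z * \<kappa>' z)"
      using assms(3,4) by (intro holo_mult) (auto simp: admissible_def)
    show "\<kappa> z * \<kappa>' z \<noteq> 0" if "z \<in> topspace (torus m r)" for z
      using assms(3,4) that by (simp add: admissible_def)
    show "\<kappa> (z(c := t)) * \<kappa>' (z(c := t)) = \<kappa> z * \<kappa>' z * (t / z c) powi e"
      if "z \<in> topspace (torus m r)" "t \<noteq> 0" for z t
      using \<kappa>''_upd[OF that] eq that torus_upd[OF that(1) c(1) that(2)] by simp
  qed (use c in auto)
qed

section \<open>The operator relations at a generic point\<close>

lemma frakC_unitarity_at:
  assumes \<tau>: "Im \<tau> > 0"
    and nz: "z (cX i) \<noteq> 0" "z (cX (i + 1)) \<noteq> 0" "z cH \<noteq> 0" "\<kappa> z \<noteq> 0"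
    and T: "theta_mult \<tau> (z (cX (i + 1)) / z (cX i)) \<noteq> 0" "theta_mult \<tau> (z cH) \<noteq> 0" "theta_mult \<tau> (\<kappa> z) \<noteq> 0"
    and \<kappa>: "\<kappa> (swp i z) = \<kappa> z"
  shows "frakC \<tau> i \<kappa> (frakC \<tau> i (\<lambda>z. 1 / \<kappa> z) f) z = delta \<tau> (z cH) (\<kappa> z) * delta \<tau> (z cH) (1 / \<kappa> z) * f z"
proof -
  define x y h a where "x = z (cX i)" and "y = z (cX (i + 1))" and "h = z cH" and "a = \<kappa> z"
  note defs = x_def[symmetric] y_def[symmetric] h_def[symmetric] a_def[symmetric]
  have sw: "swp i z (cX i) = y" "swp i z (cX (i + 1)) = x" "swp i z cH = h"
    by (simp_all add: swp_def x_def y_def h_def)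
  \<comment> \<open>The swap inverts the ratio seen by the inner operator. Oddness then cancels the
    coefficient of \<open>f (swp i z)\<close>, and unitarity evaluates that of
    \<open>f z\<close>.\<close>
  have "frakC \<tau> i \<kappa> (frakC \<tau> i (\<lambda>z. 1 / \<kappa> z) f) z =
      (delta \<tau> (y / x) a * delta \<tau> (y / x) (1 / a) + delta \<tau> (x / y) h * delta \<tau> (y / x) h) * f z
      + (delta \<tau> (y / x) a + delta \<tau> (x / y) (1 / a)) * delta \<tau> (x / y) h * f (swp i z)"
    unfolding frakC_def swap_swp sw \<kappa> defs swp_swp by (simp add: algebra_simps)
  moreover have "delta \<tau> (x / y) (1 / a) = - delta \<tau> (y / x) a"
    using delta_inverse[OF \<tau>, of "y / x" a] nz by (simp add: x_def y_def a_def)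
  moreover have "delta \<tau> (y / x) a * delta \<tau> (y / x) (1 / a) + delta \<tau> (x / y) h * delta \<tau> (y / x) h
      = delta \<tau> h a * delta \<tau> h (1 / a)"
    using delta_unitarity[OF \<tau>, of "y / x" h a] nz T by (simp add: x_def y_def a_def h_def)
  ultimately show ?thesis by (simp add: defs)
qed

lemma swp_braid: "swp 1 (swp 2 (swp 1 z)) = swp 2 (swp 1 (swp 2 z))"
  by (auto simp: swp_def fun_eq_iff numeral_eq_Suc)

text \<open>Six permuted copies of \<open>f\<close> occur. The three for permutations of length at
  least two have equal coefficients on both sides; the identity needs \<open>delta_cubic_h\<close>,
  and each simple reflection needs one Fay identity.\<close>

lemma frakC_braid_at:
  assumes \<tau>: "Im \<tau> > 0"
    and nz: "z (cX 1) \<noteq> 0" "z (cX 2) \<noteq> 0" "z (cX 3) \<noteq> 0" "z cH \<noteq> 0" "\<mu> z \<noteq> 0" "\<nu> z \<noteq> 0"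
    and T: "theta_mult \<tau> (z (cX 2) / z (cX 1)) \<noteq> 0" "theta_mult \<tau> (z (cX 3) / z (cX 2)) \<noteq> 0"
      "theta_mult \<tau> (z (cX 3) / z (cX 1)) \<noteq> 0" "theta_mult \<tau> (z cH) \<noteq> 0"
      "theta_mult \<tau> (\<mu> z) \<noteq> 0" "theta_mult \<tau> (\<nu> z) \<noteq> 0" "theta_mult \<tau> (\<mu> z * \<nu> z) \<noteq> 0"
    and inv: "\<And>i y. \<mu> (swp i y) = \<mu> y" "\<And>i y. \<nu> (swp i y) = \<nu> y"
  shows "frakC \<tau> 1 \<nu> (frakC \<tau> 2 (\<lambda>z. \<mu> z * \<nu> z) (frakC \<tau> 1 \<mu> f)) z =
    frakC \<tau> 2 \<mu> (frakC \<tau> 1 (\<lambda>z. \<mu> z * \<nu> z) (frakC \<tau> 2 \<nu> f)) z"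
proof -
  define x y w h a b where xyw: "x = z (cX 1)" "y = z (cX 2)" "w = z (cX 3)"
    and hab: "h = z cH" "a = \<mu> z" "b = \<nu> z"
  let ?d = "delta \<tau>"
  have step: "frakC \<tau> 1 \<kappa> g v = ?d (v (cX 2) / v (cX 1)) (\<kappa> v) * g v + ?d (v (cX 1) / v (cX 2)) (v cH) * g (swp 1 v)"
      "frakC \<tau> 2 \<kappa> g v = ?d (v (cX 3) / v (cX 2)) (\<kappa> v) * g v + ?d (v (cX 2) / v (cX 3)) (v cH) * g (swp 2 v)"
    for \<kappa> g v
    by (simp_all add: frakC_def swap_swp numeral_eq_Suc)
  have sw: "swp 1 v (cX 1) = v (cX 2)" "swp 1 v (cX 2) = v (cX 1)" "swp 1 v (cX 3) = v (cX 3)" "swp 1 v cH = v cH"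
    "swp 2 v (cX 1) = v (cX 1)" "swp 2 v (cX 2) = v (cX 3)" "swp 2 v (cX 3) = v (cX 2)" "swp 2 v cH = v cH" for v
    by (simp_all add: swp_def numeral_eq_Suc)
  note defs = xyw[symmetric] hab[symmetric]
  \<comment> \<open>This collects the copies common to both sides; \<open>swp_braid\<close>
    identifies the two expressions for the longest permutation.\<close>
  define L where "L = ?d (x / y) h * ?d (x / w) h * ?d (w / y) a * f (swp 2 (swp 1 z))
      + ?d (y / x) b * ?d (y / w) h * ?d (x / w) h * f (swp 1 (swp 2 z))
      + ?d (x / y) h * ?d (x / w) h * ?d (y / w) h * f (swp 1 (swp 2 (swp 1 z)))"
  have lhs: "frakC \<tau> 1 \<nu> (frakC \<tau> 2 (\<lambda>z. \<mu> z * \<nu> z) (frakC \<tau> 1 \<mu> f)) z =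
      (?d (y / x) a * ?d (y / x) b * ?d (w / y) (a * b) + ?d (x / y) h * ?d (y / x) h * ?d (w / x) (a * b)) * f z
      + (?d (w / y) (a * b) * ?d (y / x) b + ?d (w / x) (a * b) * ?d (x / y) a) * ?d (x / y) h * f (swp 1 z)
      + ?d (y / x) b * ?d (w / x) a * ?d (y / w) h * f (swp 2 z) + L"
    unfolding step sw inv swp_swp defs L_def by (simp only: algebra_simps)
  have rhs: "frakC \<tau> 2 \<mu> (frakC \<tau> 1 (\<lambda>z. \<mu> z * \<nu> z) (frakC \<tau> 2 \<nu> f)) z =
      (?d (w / y) a * ?d (w / y) b * ?d (y / x) (a * b) + ?d (y / w) h * ?d (w / y) h * ?d (w / x) (a * b)) * f z
      + ?d (w / y) a * ?d (w / x) b * ?d (x / y) h * f (swp 1 z)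
      + (?d (y / x) (a * b) * ?d (w / y) a + ?d (w / x) (a * b) * ?d (y / w) b) * ?d (y / w) h * f (swp 2 z) + L"
    unfolding step sw inv swp_swp defs L_def swp_braid by (simp only: algebra_simps)
  have nz': "x \<noteq> 0" "y \<noteq> 0" "w \<noteq> 0" "h \<noteq> 0" "a \<noteq> 0" "b \<noteq> 0"
    using nz unfolding defs by simp_all
  note T' = T[unfolded defs]
  have "?d (y / x) a * ?d (y / x) b * ?d (w / y) (a * b) + ?d (x / y) h * ?d (y / x) h * ?d (w / x) (a * b) =
      ?d (w / y) a * ?d (w / y) b * ?d (y / x) (a * b) + ?d (y / w) h * ?d (w / y) h * ?d (w / x) (a * b)"
    using delta_cubic_h[OF \<tau>, of "y / x" "w / y" h a b] nz' T' by simp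
  moreover have "?d (w / y) (a * b) * ?d (y / x) b + ?d (w / x) (a * b) * ?d (x / y) a = ?d (w / y) a * ?d (w / x) b"
    using delta_fay[OF \<tau>, of "y / x" "w / y" a b] nz' T' by simp
  \<comment> \<open>The Fay identity for the second reflection exchanges the two adjacent ratios as
    well as \<open>a\<close> and \<open>b\<close>.\<close>
  moreover have "?d (y / x) (a * b) * ?d (w / y) a + ?d (w / x) (a * b) * ?d (y / w) b = ?d (y / x) b * ?d (w / x) a"
    using delta_fay[OF \<tau>, of "w / y" "y / x" b a] nz' T' by (simp add: mult.commute)
  ultimately show ?thesis unfolding lhs rhs by simp
qed

section \<open>From generic points to equality of meromorphic functions\<close>

theorem theorem11p1:
  fixes \<tau> :: complex and m r :: nat and \<mu> \<nu> :: "point \<Rightarrow> complex"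
  assumes "Im \<tau> > 0" and "m \<ge> 3"
    and "character r \<mu>" and "character r \<nu>"
    and "\<not> trivial_mod_q \<tau> m r \<mu>"
    and "\<not> trivial_mod_q \<tau> m r \<nu>"
    and "\<not> trivial_mod_q \<tau> m r (\<lambda>z. \<mu> z * \<nu> z)"
  shows "(\<forall>f. mero m r f \<longrightarrow>
            mero_eq m r
              (frakC \<tau> 1 \<nu> (frakC \<tau> 2 (\<lambda>z. \<mu> z * \<nu> z) (frakC \<tau> 1 \<mu> f)))
              (frakC \<tau> 2 \<mu> (frakC \<tau> 1 (\<lambda>z. \<mu> z * \<nu> z) (frakC \<tau> 2 \<nu> f)))) \<and>
         (\<forall>i\<in>{1..m - 1}. \<forall>f. mero m r f \<longrightarrow>
            mero_eq m r
              (frakC \<tau> i \<mu> (frakC \<tau> i (\<lambda>z. 1 / \<mu> z) f))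
              (\<lambda>z. delta \<tau> (z cH) (\<mu> z) * delta \<tau> (z cH) (1 / \<mu> z) * f z))"
proof -
  have \<mu>: "admissible m r \<mu>" and \<nu>: "admissible m r \<nu>"
    using assms by (auto intro: admissible_character)
  then have \<mu>\<nu>: "admissible m r (\<lambda>z. \<mu> z * \<nu> z)"
    using assms by (auto intro: admissible_character_mult)
  have h: "admissible m r (\<lambda>z. z cH)"
    by (intro admissible_coord) (simp add: coords_def)
  have ratio: "admissible m r (\<lambda>z. z (cX k) / z (cX j))" if "j \<in> {1..m}" "k \<in> {1..m}" "j \<noteq> k" for j k
    using that by (intro admissible_ratio) (auto simp: coords_def)
  have nz: "z cH \<noteq> 0" "\<mu> z \<noteq> 0" "\<nu> z \<noteq> 0" "\<And>j. j \<in> {1..m} \<Longrightarrow> z (cX j) \<noteq> 0"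
    if "z \<in> topspace (torus m r)" for z
    using that \<mu> \<nu> torus_nonzero[OF that] by (auto simp: admissible_def coords_def)
  show ?thesis
  proof (intro conjI allI ballI impI)
    fix f
    show "mero_eq m r
        (frakC \<tau> 1 \<nu> (frakC \<tau> 2 (\<lambda>z. \<mu> z * \<nu> z) (frakC \<tau> 1 \<mu> f)))
        (frakC \<tau> 2 \<mu> (frakC \<tau> 1 (\<lambda>z. \<mu> z * \<nu> z) (frakC \<tau> 2 \<nu> f)))"
    \<comment> \<open>The set lists the arguments whose theta values must not vanish; inverse ratios
      are covered, since \<open>theta_mult_inverse\<close> gives them the same zeros.\<close>
    proof (rule mero_eq_generic[OF assms(1), of "{\<lambda>z. z (cX 2) / z (cX 1), \<lambda>z. z (cX 3) / z (cX 2),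
        \<lambda>z. z (cX 3) / z (cX 1), \<lambda>z. z cH, \<mu>, \<nu>, \<lambda>z. \<mu> z * \<nu> z}"], goal_cases)
      case (3 z)
      then show ?case
        using nz[OF 3(1)] assms(2) character_swp[OF assms(3)] character_swp[OF assms(4)]
        by (intro frakC_braid_at[OF assms(1)]) auto
    qed (use assms(2) \<mu> \<nu> \<mu>\<nu> h ratio in auto)
  next
    fix i f
    assume i: "i \<in> {1..m - 1}"
    show "mero_eq m r (frakC \<tau> i \<mu> (frakC \<tau> i (\<lambda>z. 1 / \<mu> z) f))
        (\<lambda>z. delta \<tau> (z cH) (\<mu> z) * delta \<tau> (z cH) (1 / \<mu> z) * f z)"
    proof (rule mero_eq_generic[OF assms(1), of "{\<lambda>z. z (cX (i + 1)) / z (cX i), \<lambda>z. z cH, \<mu>}"], goal_cases)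
      case (3 z)
      then show ?case
        using nz[OF 3(1)] i character_swp[OF assms(3)]
        by (intro frakC_unitarity_at[OF assms(1)]) auto
    qed (use i \<mu> h ratio[of i "i + 1"] in auto)
  qed
qed
end
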